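(* Let $k$ be a field of characteristic $p>0$ and let $m\ge1$ be an integer. Two polynomial matrices $A(T),B(T)\in\mathrm{Mat}(m+2,k[T])$ are called equivalent if $P^{-1}A(T)P=B(T)$ for some $P\in GL(m+2,k)$. The following assertions hold. (1) Let $A(T)=\Lambda(1,j;\alpha(T))\in(\daleth_{m+2}^{\rm II})^E$ and $B(T)=\Lambda(1,j';\beta(T))\in(\daleth_{m+2}^{\rm II})^E$, where $1\le j,j'\le m+1$. Then $A(T)$ and $B(T)$ are equivalent if and only if $j=j'$ and $\beta(T)=\alpha(T)Q$ for some $Q\in GL(j,k)$. (2) Let $A(T)=\Lambda(i,1;\alpha(T))\in(\daleth_{m+2}^{\rm III})^E$ and $B(T)=\Lambda(i',1;\beta(T))\in(\daleth_{m+2}^{\rm III})^E$, where $2\le i,i'\le m+1$. Then $A(T)$ and $B(T)$ are equivalent if and only if $i=i'$ and $\beta(T)=Q\,\alpha(T)$ for some $Q\in GL(i,k)$. (3) Let $A(T)=\Lambda(2,2;\alpha(T)),\,B(T)=\Lambda(2,2;\beta(T))\in(\daleth_{m+2}^{\rm IV})^E$, where $\alpha(T)=L(a_1\mid a_2\mid 0)\in{}^1\mathfrak{L}_1^0$, $\beta(T)=L(b_1\mid b_2\mid 0)\in{}^1\mathfrak{L}_1^0$ and $a_1,a_2,b_1,b_2\in\mathfrak{P}$. Then $A(T)$ and $B(T)$ are equivalent if and only if $(b_1,b_2)=(a_1,a_2)\,g$ for some $g\in GLDD(2,k)$. (4) Let $A(T)=\Lambda(2,2;\alpha(T)),\,B(T)=\Lambda(2,2;\beta(T))\in(\daleth_{m+2}^{\rm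 V})^E$, where $\alpha(T)=L(a_1\mid a_2\mid a)\in({}^1\mathfrak{L}_1)^{\dim=3}$, $\beta(T)=L(b_1\mid b_2\mid b)\in({}^1\mathfrak{L}_1)^{\dim=3}$ and $a_1,a_2,a,b_1,b_2,b\in\mathfrak{P}$. Then $A(T)$ and $B(T)$ are equivalent if and only if $(b_1,b_2,b)=(a_1,a_2,a)\,g$ for some $g\in V(1,1,1;k)$. (5) Let $A(T)=\Lambda(j+1,i+1;\alpha(T)),\,B(T)=\Lambda(j'+1,i'+1;\beta(T))\in(\daleth_{m+2}^{\rm VI})^E$, where $i,j,i',j'\ge1$, $3\le i+j\le m$, $3\le i'+j'\le m$, $\alpha(T)=L(a_1,\dots,a_i\mid a_{i+1},\dots,a_{i+j}\mid a)\in{}^i\mathfrak{L}_j$ with $a_1,\dots,a_{i+j},a\in\mathfrak{P}$, and $\beta(T)=L(b_1,\dots,b_{i'}\mid b_{i'+1},\dots,b_{i'+j'}\mid b)\in{}^{i'}\mathfrak{L}_{j'}$ with $b_1,\dots,b_{i'+j'},b\in\mathfrak{P}$. Then $A(T)$ and $B(T)$ are equivalent if and only if $(i,j)=(i',j')$ and $(b_1,\dots,b_i,b_{i+1},\dots,b_{i+j},b)=(a_1,\dots,a_i,a_{i+1},\dots,a_{i+j},a)\,g$ for some $g\in V(i,j,1;k)$.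
   Context: $k[T]$ is the polynomial ring in one variable. $A(T)\in\mathrm{Mat}(n,k[T])$ is exponential if $A(0)=I_n$ and $A(T)A(T')=A(T+T')$ ($T,T'$ indeterminates). For a set $S$ of polynomial matrices, $S^E$ is the set of exponential matrices in $S$. $\mathfrak{P}$ is the set of $p$-polynomials $\sum_{i\ge0}c_iT^{p^i}$, $c_i\in k$. For $i_1,i_3\ge 1$ with $i_1+i_3\le m+2$ and $\alpha(T)\in\mathrm{Mat}_{i_1,i_3}(k[T])$, $\Lambda(i_1,i_3;\alpha(T))\in\mathrm{Mat}(m+2,k[T])$ is the matrix $\begin{pmatrix} I_{i_1}&O&\alpha(T)\\ O&I_{i_2}&O\\ O&O&I_{i_3}\end{pmatrix}$ with $i_2=m+2-i_1-i_3\ge 0$. $\mathfrak{A}(i_1,i_3)^\circ$ is the set of all $\Lambda(i_1,i_3;\alpha(T))$ such that the rows of $\alpha(T)$ are linearly independent over $k$ and the columns of $\alpha(T)$ are linearly independent over $k$. For $i,j\ge 1$, ${}^i\mathfrak{L}_j$ is the set of all matrices $L(a_1,\dots,a_i\mid a_{i+1},\dots,a_{i+j}\mid a)\in\mathrm{Mat}_{j+1,i+1}(k[T])$ whose first row is $(a_1,\dots,a_i,a)$, whose last column is ${}^t(a,a_{i+1},\dots,a_{i+j})$ and whose other entries are $0$, where $a_1,\dots,a_i$ are linearly independent over $k$ and $a_{i+1},\dots,a_{i+j}$ are linearly independent over $k$. $({}^1\mathfrak{L}_1)^{\dim=3}$ is the set of $L(a_1\mid a_2\mid a)\in{}^1\mathfrak{L}_1$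 with $\dim_k\mathrm{Span}_k\{a_1,a_2,a\}=3$; ${}^1\mathfrak{L}_1^0$ is the set of $L(a_1\mid a_2\mid 0)\in{}^1\mathfrak{L}_1$. $\daleth_{m+2}^{\rm II}:=\bigcup_{1\le j\le m+1}\mathfrak{A}(1,j)^\circ$; $\daleth_{m+2}^{\rm III}:=\bigcup_{2\le i\le m+1}\mathfrak{A}(i,1)^\circ$; $\daleth_{m+2}^{\rm IV}:=\{\Lambda(2,2;L)\mid L\in{}^1\mathfrak{L}_1^0\}$ and $\daleth_{m+2}^{\rm V}:=\{\Lambda(2,2;L)\mid L\in({}^1\mathfrak{L}_1)^{\dim=3}\}$ (both empty if $m=1$); $\daleth_{m+2}^{\rm VI}:=\bigcup_{i,j\ge1,\,3\le i+j\le m}\{\Lambda(j+1,i+1;L)\mid L\in{}^i\mathfrak{L}_j\}$. $GLDD(2,k)$ is the group of matrices in $GL(2,k)$ that are either diagonal or anti-diagonal. For $i_1,i_2,i_3\ge1$, $V(i_1,i_2,i_3;k)$ is the set of matrices $\begin{pmatrix}g_{1,1}&O&g_{1,3}\\O&g_{2,2}&g_{2,3}\\O&O&g_{3,3}\end{pmatrix}$ with $g_{1,1}\in GL(i_1,k)$, $g_{2,2}\in GL(i_2,k)$, $g_{3,3}\in GL(i_3,k)$. *)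

theory Defs
  imports "Jordan_Normal_Form.Matrix" "HOL-Computational_Algebra.Polynomial"
begin

text \<open>Throughout, \<open>m\<close> is the parameter for which the matrices have size \<open>m + 2\<close>.\<close>

global_interpretation poly_vs: vector_space "smult :: 'k::field \<Rightarrow> 'k poly \<Rightarrow> 'k poly"
  by unfold_locales (simp_all add: smult_add_right smult_add_left)

text \<open>Independence as a family: repeated members make it dependent.\<close>

definition lin_indep :: "'k::field poly list \<Rightarrow> bool" where
  "lin_indep fs \<longleftrightarrow> distinct fs \<and> poly_vs.independent (set fs)"

text \<open>The embedding of \<open>Mat(k)\<close> into \<open>Mat(k[T])\<close>.\<close>

definition const_mat :: "'k::field mat \<Rightarrow> 'k poly mat" where
  "const_mat = map_mat (\<lambda>c. [:c:])"

definition lin_indep_cols :: "'k::field poly mat \<Rightarrow> bool" where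
  "lin_indep_cols \<alpha> \<longleftrightarrow>
     (\<forall>c \<in> carrier_vec (dim_col \<alpha>).
        \<alpha> *\<^sub>v map_vec (\<lambda>x. [:x:]) c = 0\<^sub>v (dim_row \<alpha>) \<longrightarrow> c = 0\<^sub>v (dim_col \<alpha>))"

definition lin_indep_rows :: "'k::field poly mat \<Rightarrow> bool" where
  "lin_indep_rows \<alpha> \<longleftrightarrow> lin_indep_cols (transpose_mat \<alpha>)"

definition GL :: "nat \<Rightarrow> 'k::field mat set" where
  "GL n = {g \<in> carrier_mat n n. invertible_mat g}"

definition GLDD2 :: "'k::field mat set" where
  "GLDD2 = {g \<in> GL 2. diagonal_mat g \<or> (g $$ (0,0) = 0 \<and> g $$ (1,1) = 0)}"

definition V :: "nat \<Rightarrow> nat \<Rightarrow> nat \<Rightarrow> 'k::field mat set" where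
  "V i1 i2 i3 =
     {four_block_mat
        (four_block_mat g11 (0\<^sub>m i1 i2) (0\<^sub>m i2 i1) g22) (g13 @\<^sub>r g23)
        (0\<^sub>m i3 (i1 + i2))                            g33
      | g11 g22 g33 g13 g23.
        g11 \<in> GL i1 \<and> g22 \<in> GL i2 \<and> g33 \<in> GL i3 \<and>
        g13 \<in> carrier_mat i1 i3 \<and> g23 \<in> carrier_mat i2 i3}"

definition poly_row :: "'k::field poly list \<Rightarrow> 'k poly mat" where
  "poly_row fs = mat_of_row (vec_of_list fs)"

definition equivalent :: "nat \<Rightarrow> 'k::field poly mat \<Rightarrow> 'k poly mat \<Rightarrow> bool" where
  "equivalent n A B \<longleftrightarrow>
     (\<exists>P \<in> GL n. \<exists>P' \<in> GL n. inverts_mat P P' \<and> inverts_mat P' P \<and>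
        const_mat P' * A * const_mat P = B)"

text \<open>The ring \<open>k[T,T']\<close> is rendered as \<open>k[T][T']\<close>: the inner variable is \<open>T\<close>,
  the outer one is \<open>T'\<close>.\<close>

definition in_T :: "'k::field poly \<Rightarrow> 'k poly poly" where
  "in_T f = [:f:]"

definition in_T' :: "'k::field poly \<Rightarrow> 'k poly poly" where
  "in_T' f = map_poly (\<lambda>c. [:c:]) f"

definition in_T_plus_T' :: "'k::field poly \<Rightarrow> 'k poly poly" where
  "in_T_plus_T' f = poly (map_poly (\<lambda>c. [:[:c:]:]) f) (in_T [:0, 1:] + in_T' [:0, 1:])"

definition exponential :: "'k::field poly mat \<Rightarrow> bool" where
  "exponential A \<longleftrightarrow> square_mat A \<and>
     map_mat (\<lambda>f. poly f 0) A = 1\<^sub>m (dim_row A) \<and>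
     map_mat in_T A * map_mat in_T' A = map_mat in_T_plus_T' A"

definition Exp_part :: "'k::field poly mat set \<Rightarrow> 'k poly mat set"  (\<open>_\<^sup>E\<close> [1000] 1000) where
  "S\<^sup>E = {A \<in> S. exponential A}"

definition p_polys :: "nat \<Rightarrow> 'k::field poly set" where
  "p_polys p = {\<Sum>i<N. monom (c i) (p ^ i) | N c. True}"

text \<open>The usual three-by-three block form with its two leading identity blocks merged;
  meaningful only for \<open>i1 + i3 \<le> m + 2\<close> (the subtraction truncates).\<close>

definition Lambda :: "nat \<Rightarrow> nat \<Rightarrow> nat \<Rightarrow> 'k::field poly mat \<Rightarrow> 'k poly mat" where
  "Lambda m i1 i3 \<alpha> =
     (let i2 = m + 2 - i1 - i3 in
      four_block_mat
        (1\<^sub>m (i1 + i2))      (\<alpha> @\<^sub>r 0\<^sub>m i2 i3)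
        (0\<^sub>m i3 (i1 + i2))   (1\<^sub>m i3))"

definition frakA :: "nat \<Rightarrow> nat \<Rightarrow> nat \<Rightarrow> 'k::field poly mat set" where
  "frakA m i1 i3 =
     {Lambda m i1 i3 \<alpha> | \<alpha>. i1 \<ge> 1 \<and> i3 \<ge> 1 \<and> i1 + i3 \<le> m + 2 \<and>
        \<alpha> \<in> carrier_mat i1 i3 \<and> lin_indep_rows \<alpha> \<and> lin_indep_cols \<alpha>}"

text \<open>\<open>Lmat as bs a\<close> is the matrix \<open>L(as | bs | a)\<close>. Indices start at 0, so the first row is
  \<open>as @ [a]\<close> and the last column is \<open>a # bs\<close>.\<close>

definition Lmat :: "'k::field poly list \<Rightarrow> 'k poly list \<Rightarrow> 'k poly \<Rightarrow> 'k poly mat" where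
  "Lmat as bs a = mat (length bs + 1) (length as + 1) (\<lambda>(r, s).
     if r = 0 then (as @ [a]) ! s
     else if s = length as then (a # bs) ! r
     else 0)"

definition frakL :: "nat \<Rightarrow> nat \<Rightarrow> 'k::field poly mat set" where
  "frakL i j =
     {Lmat as bs a | as bs a. i \<ge> 1 \<and> j \<ge> 1 \<and> length as = i \<and> length bs = j \<and>
        lin_indep as \<and> lin_indep bs}"

definition frakL11_dim3 :: "'k::field poly mat set" where
  "frakL11_dim3 = {Lmat [a1] [a2] a | a1 a2 a.
     Lmat [a1] [a2] a \<in> frakL 1 1 \<and> poly_vs.dim (poly_vs.span {a1, a2, a}) = 3}"

definition frakL11_0 :: "'k::field poly mat set" where
  "frakL11_0 = {Lmat [a1] [a2] 0 | a1 a2. Lmat [a1] [a2] 0 \<in> frakL 1 1}"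

definition daleth_II :: "nat \<Rightarrow> 'k::field poly mat set" where
  "daleth_II m = (\<Union>j\<in>{1..m + 1}. frakA m 1 j)"

definition daleth_III :: "nat \<Rightarrow> 'k::field poly mat set" where
  "daleth_III m = (\<Union>i\<in>{2..m + 1}. frakA m i 1)"

text \<open>\<open>m \<ge> 2\<close> is the size condition \<open>2 + 2 \<le> m + 2\<close> of \<open>Lambda m 2 2\<close>.\<close>

definition daleth_IV :: "nat \<Rightarrow> 'k::field poly mat set" where
  "daleth_IV m = {Lambda m 2 2 L | L. m \<ge> 2 \<and> L \<in> frakL11_0}"

definition daleth_V :: "nat \<Rightarrow> 'k::field poly mat set" where
  "daleth_V m = {Lambda m 2 2 L | L. m \<ge> 2 \<and> L \<in> frakL11_dim3}"

definition daleth_VI :: "nat \<Rightarrow> 'k::field poly mat set" where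
  "daleth_VI m =
     (\<Union>(i, j)\<in>{(i, j). i \<ge> 1 \<and> j \<ge> 1 \<and> 3 \<le> i + j \<and> i + j \<le> m}.
        {Lambda m (j + 1) (i + 1) L | L. L \<in> frakL i j})"

end

theory Submission
  imports Defs "Jordan_Normal_Form.Determinant"
begin

text \<open>Write \<open>A = I + N\<close>, \<open>B = I + N'\<close> with \<open>N\<close>, \<open>N'\<close> carrying \<open>\<alpha>\<close>, \<open>\<beta>\<close> in the upper right
  corner. If \<open>A P = P B\<close> with \<open>P\<close> constant, then \<open>N P = P N'\<close>, and independence over \<open>k\<close> of the
  columns of \<open>\<alpha>\<close> and of the rows of \<open>\<beta>\<close> makes \<open>P\<close> block upper triangular. As the same holds for
  the inverse of \<open>P\<close>, the extreme diagonal blocks \<open>Q\<close>, \<open>R\<close> of \<open>P\<close> are square and invertible, the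
  block sizes of \<open>A\<close> and \<open>B\<close> agree, and \<open>\<alpha> R = Q \<beta>\<close>; conversely \<open>diag(Q, I, R)\<close> conjugates \<open>A\<close>
  to \<open>B\<close>. So only the equation \<open>\<alpha> R = Q \<beta>\<close> has to be solved.

  For \<open>\<alpha> = L(a | a' | c)\<close> and \<open>\<beta> = L(b | b' | d)\<close> its lower left block reads
  \<open>a'\<^sub>t R\<^sub>s = Q\<^sub>t b\<^sub>s\<close>. If two of the \<open>a'\<^sub>t\<close> or two of the \<open>b\<^sub>s\<close> are available, independence forces
  \<open>R\<^sub>s = Q\<^sub>t = 0\<close>; for \<open>i = j = 1\<close> the same follows from the lower right entry when \<open>b, b', d\<close> are
  independent. What remains of \<open>Q\<close> and \<open>R\<close> is the action of \<open>V(i, j, 1; k)\<close>. For \<open>i = j = 1\<close> and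
  \<open>c = d = 0\<close> the corner may survive, which is where the anti-diagonal matrices come from.\<close>

section \<open>Constant matrices inside the polynomial matrices\<close>

interpretation const_hom: semiring_hom "\<lambda>c :: 'k::field. [:c:]"
  by unfold_locales (auto simp: one_pCons)

lemma const_mat_carrier [simp]: "const_mat A \<in> carrier_mat n m \<longleftrightarrow> A \<in> carrier_mat n m"
  by (auto simp: const_mat_def)

lemma dim_const_mat [simp]:
  "dim_row (const_mat A) = dim_row A" "dim_col (const_mat A) = dim_col A"
  by (simp_all add: const_mat_def)

lemma index_const_mat [simp]:
  "i < dim_row A \<Longrightarrow> j < dim_col A \<Longrightarrow> const_mat A $$ (i, j) = [:A $$ (i, j):]"
  by (simp add: const_mat_def)

lemma const_mat_zero [simp]: "const_mat (0\<^sub>m n m) = 0\<^sub>m n m"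
  by (rule eq_matI) auto

lemma const_mat_one [simp]: "const_mat (1\<^sub>m n) = 1\<^sub>m n"
  unfolding const_mat_def by (rule const_hom.mat_hom_one)

lemma const_mat_mult:
  "A \<in> carrier_mat n m \<Longrightarrow> B \<in> carrier_mat m l \<Longrightarrow>
    const_mat (A * B) = const_mat A * const_mat B"
  unfolding const_mat_def by (rule const_hom.mat_hom_mult)

lemma const_mat_four_block:
  assumes "A \<in> carrier_mat nr1 nc1" "B \<in> carrier_mat nr1 nc2"
    "C \<in> carrier_mat nr2 nc1" "D \<in> carrier_mat nr2 nc2"
  shows "const_mat (four_block_mat A B C D) =
    four_block_mat (const_mat A) (const_mat B) (const_mat C) (const_mat D)"
  unfolding const_mat_def by (rule map_four_block_mat[OF assms])

lemma const_mat_transpose: "const_mat (transpose_mat A) = transpose_mat (const_mat A)"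
  by (rule eq_matI) auto

subsection \<open>Invertible constant matrices\<close>

text \<open>\<open>inverts_mat\<close> compares a product with an identity sized by its left factor
  and leaves the shape of the inverse open. The column counts of the two products show that the
  inverse is again n by n.\<close>

lemma GL_iff:
  "g \<in> GL n \<longleftrightarrow> g \<in> carrier_mat n n \<and> (\<exists>h \<in> carrier_mat n n. g * h = 1\<^sub>m n \<and> h * g = 1\<^sub>m n)"
proof
  assume g: "g \<in> GL n"
  then obtain h where h: "g * h = 1\<^sub>m (dim_row g)" "h * g = 1\<^sub>m (dim_row h)"
    and gc: "g \<in> carrier_mat n n"
    by (auto simp: GL_def invertible_mat_def inverts_mat_def)
  have "dim_col h = n" using arg_cong[OF h(1), of dim_col] gc by auto
  moreover have "dim_row h = n" using arg_cong[OF h(2), of dim_col] gc by auto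
  ultimately show "g \<in> carrier_mat n n \<and> (\<exists>h \<in> carrier_mat n n. g * h = 1\<^sub>m n \<and> h * g = 1\<^sub>m n)"
    using h gc by (intro conjI bexI[of _ h]) auto
qed (auto simp: GL_def invertible_mat_def inverts_mat_def)

lemma GL_carrier: "g \<in> GL n \<Longrightarrow> g \<in> carrier_mat n n"
  by (simp add: GL_def)

lemma GL_inverse:
  assumes "g \<in> GL n"
  obtains h where "h \<in> GL n" "g * h = 1\<^sub>m n" "h * g = 1\<^sub>m n"
  using assms by (auto simp: GL_iff)

lemma GL_I:
  fixes g h :: "'k::field mat"
  assumes "g \<in> carrier_mat n n" "h \<in> carrier_mat n n" "g * h = 1\<^sub>m n"
  shows "g \<in> GL n"
  using assms mat_mult_left_right_inverse[OF assms] by (auto simp: GL_iff)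

lemma one_mat_GL: "1\<^sub>m n \<in> GL n"
  by (auto simp: GL_iff)

lemma GL_transpose:
  fixes g :: "'k::field mat"
  assumes "g \<in> GL n"
  shows "transpose_mat g \<in> GL n"
proof -
  obtain h where h: "h \<in> GL n" "h * g = 1\<^sub>m n" using GL_inverse[OF assms] by metis
  then have "transpose_mat g * transpose_mat h = 1\<^sub>m n"
    using transpose_mult[OF GL_carrier[OF h(1)] GL_carrier[OF assms]] by simp
  then show ?thesis using GL_carrier[OF assms] GL_carrier[OF h(1)]
    by (intro GL_I[of _ n "transpose_mat h"]) auto
qed

lemma GL_smult:
  fixes g :: "'k::field mat"
  assumes "g \<in> GL n" "c \<noteq> 0"
  shows "c \<cdot>\<^sub>m g \<in> GL n"
proof -
  obtain h where h: "h \<in> GL n" "g * h = 1\<^sub>m n" using GL_inverse[OF assms(1)] by metis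
  note gh = GL_carrier[OF assms(1)] GL_carrier[OF h(1)]
  have "(c \<cdot>\<^sub>m g) * (inverse c \<cdot>\<^sub>m h) = (c * inverse c) \<cdot>\<^sub>m (g * h)"
    using gh by (intro eq_matI) auto
  also have "\<dots> = 1\<^sub>m n" using h assms by (simp, intro eq_matI) auto
  finally show ?thesis using gh by (intro GL_I[of _ n "inverse c \<cdot>\<^sub>m h"]) auto
qed

text \<open>Written as multiples of the identity, one-by-one diagonal blocks can be moved around as
  scalars; this is what the orbit computations below rely on.\<close>

lemma GL_1_iff: "(g :: 'k::field mat) \<in> GL 1 \<longleftrightarrow> (\<exists>c. c \<noteq> 0 \<and> g = c \<cdot>\<^sub>m 1\<^sub>m 1)"
proof
  assume g: "g \<in> GL 1"
  then obtain h where h: "h \<in> GL 1" "g * h = 1\<^sub>m 1" using GL_inverse by metis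
  note gh = GL_carrier[OF g] GL_carrier[OF h(1)]
  have "g $$ (0,0) * h $$ (0,0) = 1"
    using arg_cong[OF h(2), of "\<lambda>A. A $$ (0,0)"] gh by (simp add: scalar_prod_def)
  then show "\<exists>c. c \<noteq> 0 \<and> g = c \<cdot>\<^sub>m 1\<^sub>m 1"
    using gh by (intro exI[of _ "g $$ (0,0)"]) (auto intro!: eq_matI)
next
  assume "\<exists>c. c \<noteq> 0 \<and> g = c \<cdot>\<^sub>m 1\<^sub>m 1"
  then show "g \<in> GL 1" using GL_smult[OF one_mat_GL] by blast
qed

section \<open>Block decompositions and inverses of block triangular matrices\<close>

lemma four_block_mat_split:
  assumes "A \<in> carrier_mat (r1 + r2) (c1 + c2)"
  obtains A1 A2 A3 A4 where "A1 \<in> carrier_mat r1 c1" "A2 \<in> carrier_mat r1 c2"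
    "A3 \<in> carrier_mat r2 c1" "A4 \<in> carrier_mat r2 c2" "A = four_block_mat A1 A2 A3 A4"
proof -
  obtain A1 A2 A3 A4 where s: "split_block A r1 c1 = (A1, A2, A3, A4)"
    by (metis prod_cases4)
  have dims: "dim_row A = r1 + r2" "dim_col A = c1 + c2" using assms by auto
  show ?thesis using split_block[OF s dims] by (rule that)
qed

lemma four_block_mat_inj:
  assumes "A1 \<in> carrier_mat r1 c1" "A2 \<in> carrier_mat r1 c2"
    "A3 \<in> carrier_mat r2 c1" "A4 \<in> carrier_mat r2 c2"
    and "B1 \<in> carrier_mat r1 c1" "B2 \<in> carrier_mat r1 c2"
    "B3 \<in> carrier_mat r2 c1" "B4 \<in> carrier_mat r2 c2"
  shows "four_block_mat A1 A2 A3 A4 = four_block_mat B1 B2 B3 B4 \<longleftrightarrow>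
    A1 = B1 \<and> A2 = B2 \<and> A3 = B3 \<and> A4 = B4"
proof
  assume eq: "four_block_mat A1 A2 A3 A4 = four_block_mat B1 B2 B3 B4"
  have e: "four_block_mat A1 A2 A3 A4 $$ (i, j) = four_block_mat B1 B2 B3 B4 $$ (i, j)" for i j
    using eq by simp
  have "A1 $$ (i, j) = B1 $$ (i, j)" if "i < r1" "j < c1" for i j
    using e[of i j] that assms by auto
  moreover have "A2 $$ (i, j) = B2 $$ (i, j)" if "i < r1" "j < c2" for i j
    using e[of i "j + c1"] that assms by auto
  moreover have "A3 $$ (i, j) = B3 $$ (i, j)" if "i < r2" "j < c1" for i j
    using e[of "i + r1" j] that assms by auto
  moreover have "A4 $$ (i, j) = B4 $$ (i, j)" if "i < r2" "j < c2" for i j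
    using e[of "i + r1" "j + c1"] that assms by auto
  ultimately show "A1 = B1 \<and> A2 = B2 \<and> A3 = B3 \<and> A4 = B4"
    using assms by (intro conjI eq_matI) auto
qed simp

text \<open>If r > c, padding \<open>A\<close> with zero columns and \<open>B\<close> with zero rows
  gives square matrices whose product is still the identity. Then the product in the other order is
  the identity as well, although its last r - c rows vanish.\<close>

lemma one_sided_inverse_dim_le:
  fixes A B :: "'k::field mat"
  assumes A: "A \<in> carrier_mat r c" and B: "B \<in> carrier_mat c r" and AB: "A * B = 1\<^sub>m r"
  shows "r \<le> c"
proof (rule ccontr)
  assume "\<not> r \<le> c"
  then obtain d where r: "r = c + d" and d: "d > 0" by (metis less_imp_add_positive not_le)
  \<comment> \<open>Blocks without rows or without columns let \<open>four_block_mat\<close> express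
    one-sided padding.\<close>
  define A' where "A' = four_block_mat A (0\<^sub>m r d) (0\<^sub>m 0 c) (0\<^sub>m 0 d)"
  define B' where "B' = four_block_mat B (0\<^sub>m c 0) (0\<^sub>m d r) (0\<^sub>m d 0)"
  have A': "A' \<in> carrier_mat r r" and B': "B' \<in> carrier_mat r r"
    using A B unfolding A'_def B'_def r by (auto intro!: carrier_matI)
  have "A' * B' = four_block_mat (A * B) (0\<^sub>m r 0) (0\<^sub>m 0 r) (0\<^sub>m 0 0)"
    unfolding A'_def B'_def
    by (subst mult_four_block_mat[of _ r c _ d _ 0 _ _ r _ 0]) (use A B in auto)
  also have "\<dots> = 1\<^sub>m r" unfolding AB by (rule eq_matI) auto
  finally have 1: "B' * A' = 1\<^sub>m r" by (rule mat_mult_left_right_inverse[OF A' B'])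
  have "B' * A' = four_block_mat (B * A) (0\<^sub>m c d) (0\<^sub>m d c) (0\<^sub>m d d)"
    unfolding A'_def B'_def
    by (subst mult_four_block_mat[of _ c r _ 0 _ d _ _ c _ d]) (use A B in auto)
  \<comment> \<open>The position (c, c) is the first diagonal entry beyond the block
    \<open>B * A\<close>; it exists because d > 0.\<close>
  then have "(B' * A') $$ (c, c) = 0" using A B d by simp
  then show False unfolding 1 using r d by simp
qed

text \<open>Because both lower left blocks vanish, the diagonal blocks multiply among themselves and
  give identities in both orders. A pair of rectangular matrices that are inverse in both orders
  must be square, so the two block patterns, a priori unrelated, coincide.\<close>

lemma GL_block_triangular_corners:
  fixes P1 P2 P4 P1' P2' P4' :: "'k::field mat"
  assumes P: "P1 \<in> carrier_mat a a'" "P2 \<in> carrier_mat a c'" "P4 \<in> carrier_mat c c'"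
    and P': "P1' \<in> carrier_mat a' a" "P2' \<in> carrier_mat a' c" "P4' \<in> carrier_mat c' c"
    and n: "a + c = n" "a' + c' = n"
    and inv: "four_block_mat P1 P2 (0\<^sub>m c a') P4 * four_block_mat P1' P2' (0\<^sub>m c' a) P4' = 1\<^sub>m n"
      "four_block_mat P1' P2' (0\<^sub>m c' a) P4' * four_block_mat P1 P2 (0\<^sub>m c a') P4 = 1\<^sub>m n"
  shows "a = a'" "c = c'" "P1 * P1' = 1\<^sub>m a" "P4 * P4' = 1\<^sub>m c" "P1' * P1 = 1\<^sub>m a" "P4' * P4 = 1\<^sub>m c"
proof -
  have "four_block_mat (P1 * P1') (P1 * P2' + P2 * P4') (0\<^sub>m c a) (P4 * P4') =
      four_block_mat (1\<^sub>m a) (0\<^sub>m a c) (0\<^sub>m c a) (1\<^sub>m c)"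
    using inv(1) P P' by (subst (asm) mult_four_block_mat[of _ a a' _ c' _ c _ _ a _ c])
      (auto simp: n)
  then have 1: "P1 * P1' = 1\<^sub>m a" "P4 * P4' = 1\<^sub>m c"
    by (subst (asm) four_block_mat_inj[of _ a a _ c _ c]; use P P' in auto)+
  have "four_block_mat (P1' * P1) (P1' * P2 + P2' * P4) (0\<^sub>m c' a') (P4' * P4) =
      four_block_mat (1\<^sub>m a') (0\<^sub>m a' c') (0\<^sub>m c' a') (1\<^sub>m c')"
    using inv(2) P P' by (subst (asm) mult_four_block_mat[of _ a' a _ c _ c' _ _ a' _ c'])
      (auto simp: n)
  then have 2: "P1' * P1 = 1\<^sub>m a'" "P4' * P4 = 1\<^sub>m c'"
    by (subst (asm) four_block_mat_inj[of _ a' a' _ c' _ c']; use P P' in auto)+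
  show "a = a'" "c = c'"
    using one_sided_inverse_dim_le[OF P(1) P'(1) 1(1)] one_sided_inverse_dim_le[OF P'(1) P(1) 2(1)]
      one_sided_inverse_dim_le[OF P(3) P'(3) 1(2)] one_sided_inverse_dim_le[OF P'(3) P(3) 2(2)]
    by auto
  then show "P1 * P1' = 1\<^sub>m a" "P4 * P4' = 1\<^sub>m c" "P1' * P1 = 1\<^sub>m a" "P4' * P4 = 1\<^sub>m c"
    using 1 2 by auto
qed

section \<open>Independence as cancellation of constant factors, and padding by zero rows\<close>

text \<open>Each column of \<open>X\<close> holds the coefficients of a vanishing combination of the
  columns of \<alpha>. In this form independence removes a whole block of a matrix at once.\<close>

lemma lin_indep_cols_mult_zero:
  assumes \<alpha>: "\<alpha> \<in> carrier_mat r c" and ind: "lin_indep_cols \<alpha>"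
    and X: "X \<in> carrier_mat c n" and z: "\<alpha> * const_mat X = 0\<^sub>m r n"
  shows "X = 0\<^sub>m c n"
proof (rule eq_matI)
  fix i j assume ij: "i < dim_row (0\<^sub>m c n :: 'a mat)" "j < dim_col (0\<^sub>m c n :: 'a mat)"
  have "map_vec (\<lambda>x. [:x:]) (col X j) = col (const_mat X) j"
    using X ij by (intro eq_vecI) auto
  then have "\<alpha> *\<^sub>v map_vec (\<lambda>x. [:x:]) (col X j) = col (\<alpha> * const_mat X) j"
    using \<alpha> X ij by auto
  also have "\<dots> = 0\<^sub>v r" using ij by (auto simp: z)
  finally have "col X j = 0\<^sub>v c"
    using ind \<alpha> X ij by (auto simp: lin_indep_cols_def)
  then show "X $$ (i, j) = 0\<^sub>m c n $$ (i, j)"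
    using ij X by (metis carrier_matD col_def index_vec index_zero_mat index_zero_vec(1))
qed (use X in auto)

lemma lin_indep_rows_mult_zero:
  assumes \<alpha>: "\<alpha> \<in> carrier_mat r c" and ind: "lin_indep_rows \<alpha>"
    and X: "X \<in> carrier_mat n r" and z: "const_mat X * \<alpha> = 0\<^sub>m n c"
  shows "X = 0\<^sub>m n r"
proof -
  have "transpose_mat \<alpha> * const_mat (transpose_mat X) = transpose_mat (const_mat X * \<alpha>)"
    using \<alpha> X by (simp add: const_mat_transpose transpose_mult[of _ n r])
  also have "\<dots> = 0\<^sub>m c n" by (simp add: z)
  finally have "transpose_mat X = 0\<^sub>m r n"
    using lin_indep_cols_mult_zero[of "transpose_mat \<alpha>" c r] \<alpha> X ind
    by (auto simp: lin_indep_rows_def)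
  then show ?thesis by (metis transpose_transpose zero_transpose_mat)
qed

lemma append_rows_inj:
  assumes "A \<in> carrier_mat r c" "A' \<in> carrier_mat r c" "B \<in> carrier_mat s c" "B' \<in> carrier_mat s c"
  shows "A @\<^sub>r B = A' @\<^sub>r B' \<longleftrightarrow> A = A' \<and> B = B'"
  using assms by (auto simp: append_rows_def four_block_mat_inj[of _ r c _ 0 _ s])

lemma append_rows_zero_mult:
  assumes "A \<in> carrier_mat r c" "X \<in> carrier_mat c n"
  shows "(A @\<^sub>r 0\<^sub>m s c) * X = (A * X) @\<^sub>r 0\<^sub>m s n"
proof -
  \<comment> \<open>\<open>append_rows\<close> is a block matrix whose right-hand blocks have no
    columns, so the other factor needs matching blocks without rows before block multiplication
    applies.\<close>
  have "X = four_block_mat X (0\<^sub>m c 0) (0\<^sub>m 0 n) (0\<^sub>m 0 0)" using assms by (intro eq_matI) auto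
  then have "(A @\<^sub>r 0\<^sub>m s c) * X = four_block_mat A (0\<^sub>m r 0) (0\<^sub>m s c) (0\<^sub>m s 0) *
     four_block_mat X (0\<^sub>m c 0) (0\<^sub>m 0 n) (0\<^sub>m 0 0)"
    using assms by (simp add: append_rows_def)
  also have "\<dots> = (A * X) @\<^sub>r 0\<^sub>m s n"
    using assms by (subst mult_four_block_mat[of _ r c _ 0 _ s _ _ n _ 0])
      (auto simp: append_rows_def)
  finally show ?thesis .
qed

lemma four_block_mult_append_rows_zero:
  assumes "A \<in> carrier_mat r1 c1" "B \<in> carrier_mat r1 c2" "C \<in> carrier_mat r2 c1"
    "D \<in> carrier_mat r2 c2" "X \<in> carrier_mat c1 n"
  shows "four_block_mat A B C D * (X @\<^sub>r 0\<^sub>m c2 n) = (A * X) @\<^sub>r (C * X)"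
  using assms unfolding append_rows_def
  by (subst mult_four_block_mat[of _ r1 c1 _ c2 _ r2 _ _ n _ 0]) (auto simp: append_rows_def)

lemma append_rows_zero_zero: "0\<^sub>m r c @\<^sub>r 0\<^sub>m s c = (0\<^sub>m (r + s) c)"
  by (rule eq_matI) (auto simp: append_rows_def)

subsection \<open>Conjugating the matrices \<open>\<Lambda>(i\<^sub>1, i\<^sub>3; \<alpha>)\<close>\<close>

text \<open>Here the size \<open>m + 2 - i3\<close> of the leading block no longer mentions
  \<open>i1\<close>, so the outer decomposition depends on \<open>i3\<close> alone. The bound makes
  the truncated subtractions add up.\<close>

lemma Lambda_eq_four_block:
  assumes "i1 + i3 \<le> m + 2" 
  shows "Lambda m i1 i3 \<alpha> = four_block_mat (1\<^sub>m (m + 2 - i3)) (\<alpha> @\<^sub>r 0\<^sub>m (m + 2 - i3 - i1) i3)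
    (0\<^sub>m i3 (m + 2 - i3)) (1\<^sub>m i3)"
proof -
  have "i1 + (m + 2 - i1 - i3) = m + 2 - i3" "m + 2 - i1 - i3 = m + 2 - i3 - i1"
    using assms by auto
  then show ?thesis by (simp only: Lambda_def Let_def)
qed

lemma Lambda_carrier:
  assumes "\<alpha> \<in> carrier_mat i1 i3" "i1 + i3 \<le> m + 2"
  shows "Lambda m i1 i3 \<alpha> \<in> carrier_mat (m + 2) (m + 2)"
proof -
  have "i3 \<le> m + 2" using assms by simp
  then show ?thesis unfolding Lambda_eq_four_block[OF assms(2)]
    by (intro carrier_matI) auto
qed

text \<open>The common summand stands on opposite sides because the upper right blocks of the two
  products in \<open>Lambda_intertwiner\<close> present it in this way.\<close>

lemma add_cancel_mat:
  fixes A B C :: "'a::ab_group_add mat"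
  assumes "A \<in> carrier_mat r c" "B \<in> carrier_mat r c" "C \<in> carrier_mat r c" "A + B = C + A"
  shows "B = C"
proof (rule eq_matI)
  fix i j assume "i < dim_row C" "j < dim_col C"
  then show "B $$ (i, j) = C $$ (i, j)"
    using arg_cong[OF assms(4), of "\<lambda>X. X $$ (i, j)"] assms(1-3) by (simp add: add.commute)
qed (use assms in auto)

text \<open>Membership in a set of the form {\<open>Lambda m i1 i3 \<alpha>\<close> | ...} only
  speaks of some representative; injectivity carries its properties over to the given one.\<close>

lemma Lambda_inj:
  assumes "i1 + i3 \<le> m + 2" "\<alpha> \<in> carrier_mat i1 i3" "\<beta> \<in> carrier_mat i1 i3"
    and eq: "Lambda m i1 i3 \<alpha> = Lambda m i1 i3 \<beta>"
  shows "\<alpha> = \<beta>"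
proof -
  have c: "\<gamma> @\<^sub>r 0\<^sub>m (m + 2 - i3 - i1) i3 \<in> carrier_mat (m + 2 - i3) i3" if "\<gamma> \<in> carrier_mat i1 i3" for \<gamma> :: "'a poly mat"
    using carrier_append_rows[OF that zero_carrier_mat, of "m + 2 - i3 - i1"] assms(1) by simp
  have "\<alpha> @\<^sub>r 0\<^sub>m (m + 2 - i3 - i1) i3 = \<beta> @\<^sub>r 0\<^sub>m (m + 2 - i3 - i1) i3"
    using eq c[OF assms(2)] c[OF assms(3)] unfolding Lambda_eq_four_block[OF assms(1)]
    by (subst (asm) four_block_mat_inj) auto
  then show ?thesis using assms by (subst (asm) append_rows_inj) auto
qed

text \<open>Split \<open>P\<close> into \<open>U\<close>, \<open>P13\<close>, \<open>W\<close>,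
  \<open>P3\<close> and \<open>U\<close> further into \<open>P1\<close>, \<open>P12\<close>,
  \<open>Z\<close>, \<open>P2\<close>. The upper left blocks of the two products give \<alpha> W =
  0, the upper right ones \<alpha> P3 = P1 \<beta> and Z \<beta> = 0. Independence of the columns of
  \<alpha> kills \<open>W\<close>, independence of the rows of \<beta> kills
  \<open>Z\<close>.\<close>

lemma Lambda_intertwiner:
  assumes \<alpha>: "\<alpha> \<in> carrier_mat i1 i3" "lin_indep_cols \<alpha>" "i1 + i3 \<le> m + 2"
    and \<beta>: "\<beta> \<in> carrier_mat j1 j3" "lin_indep_rows \<beta>" "j1 + j3 \<le> m + 2"
    and P: "P \<in> carrier_mat (m + 2) (m + 2)"
    and eq: "Lambda m i1 i3 \<alpha> * const_mat P = const_mat P * Lambda m j1 j3 \<beta>"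
  obtains P1 P12 P2 P13 P3 where
    "P1 \<in> carrier_mat i1 j1" "P12 \<in> carrier_mat i1 (m + 2 - j3 - j1)"
    "P2 \<in> carrier_mat (m + 2 - i3 - i1) (m + 2 - j3 - j1)"
    "P13 \<in> carrier_mat (m + 2 - i3) j3" "P3 \<in> carrier_mat i3 j3"
    "P = four_block_mat (four_block_mat P1 P12 (0\<^sub>m (m + 2 - i3 - i1) j1) P2) P13
           (0\<^sub>m i3 (m + 2 - j3)) P3"
    "\<alpha> * const_mat P3 = const_mat P1 * \<beta>"
proof -
  define a b where "a = m + 2 - i3" and "b = m + 2 - j3"
  have dims: "a + i3 = m + 2" "b + j3 = m + 2" "i1 + (a - i1) = a" "j1 + (b - j1) = b"
    "m + 2 - i3 - i1 = a - i1" "m + 2 - j3 - j1 = b - j1"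
    using \<alpha>(3) \<beta>(3) by (auto simp: a_def b_def)
  have "P \<in> carrier_mat (a + i3) (b + j3)" using P dims by metis
  then obtain U P13 W P3 where UW: "U \<in> carrier_mat a b" "P13 \<in> carrier_mat a j3"
    "W \<in> carrier_mat i3 b" "P3 \<in> carrier_mat i3 j3" "P = four_block_mat U P13 W P3"
    by (rule four_block_mat_split)
  have "U \<in> carrier_mat (i1 + (a - i1)) (j1 + (b - j1))" using UW dims by metis
  then obtain P1 P12 Z P2 where PZ: "P1 \<in> carrier_mat i1 j1" "P12 \<in> carrier_mat i1 (b - j1)"
    "Z \<in> carrier_mat (a - i1) j1" "P2 \<in> carrier_mat (a - i1) (b - j1)"
    "U = four_block_mat P1 P12 Z P2"
    by (rule four_block_mat_split)
  let ?\<alpha> = "\<alpha> @\<^sub>r 0\<^sub>m (a - i1) i3" and ?\<beta> = "\<beta> @\<^sub>r 0\<^sub>m (b - j1) j3"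
  have \<alpha>c: "?\<alpha> \<in> carrier_mat a i3"
    using carrier_append_rows[OF \<alpha>(1) zero_carrier_mat, of "a - i1"] unfolding dims .
  have \<beta>c: "?\<beta> \<in> carrier_mat b j3"
    using carrier_append_rows[OF \<beta>(1) zero_carrier_mat, of "b - j1"] unfolding dims .
  have "Lambda m i1 i3 \<alpha> * const_mat P =
      four_block_mat (const_mat U + ?\<alpha> * const_mat W) (const_mat P13 + ?\<alpha> * const_mat P3)
        (const_mat W) (const_mat P3)"
    unfolding Lambda_eq_four_block[OF \<alpha>(3)] a_def[symmetric] UW(5) const_mat_four_block[OF UW(1-4)]
    by (subst mult_four_block_mat[of _ a a _ i3 _ i3 _ _ b _ j3]) (use UW \<alpha>c in auto)
  moreover have "const_mat P * Lambda m j1 j3 \<beta> =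
      four_block_mat (const_mat U) (const_mat U * ?\<beta> + const_mat P13)
        (const_mat W) (const_mat W * ?\<beta> + const_mat P3)"
    unfolding Lambda_eq_four_block[OF \<beta>(3)] b_def[symmetric] UW(5) const_mat_four_block[OF UW(1-4)]
    by (subst mult_four_block_mat[of _ a b _ j3 _ i3 _ _ b _ j3]) (use UW \<beta>c in auto)
  ultimately have "four_block_mat (const_mat U + ?\<alpha> * const_mat W) (const_mat P13 + ?\<alpha> * const_mat P3)
        (const_mat W) (const_mat P3) = four_block_mat (const_mat U) (const_mat U * ?\<beta> + const_mat P13)
        (const_mat W) (const_mat W * ?\<beta> + const_mat P3)"
    using eq by simp
  then have 1: "const_mat U + ?\<alpha> * const_mat W = const_mat U"
    and 2: "const_mat P13 + ?\<alpha> * const_mat P3 = const_mat U * ?\<beta> + const_mat P13"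
    by (subst (asm) four_block_mat_inj[of _ a b _ j3 _ i3]; use UW \<alpha>c \<beta>c in simp)+
  have cU: "const_mat U \<in> carrier_mat a b" and cW: "?\<alpha> * const_mat W \<in> carrier_mat a b"
    using UW(1,3) \<alpha>c by auto
  \<comment> \<open>The upper left blocks differ by exactly this product; below its first
    \<open>i1\<close> rows it is zero anyway, so all the information sits in \<alpha> W.\<close>
  have "?\<alpha> * const_mat W = 0\<^sub>m a b"
    by (rule add_cancel_mat[OF cU cW zero_carrier_mat]) (simp add: 1 left_add_zero_mat[OF cU])
  then have "(\<alpha> * const_mat W) @\<^sub>r 0\<^sub>m (a - i1) b = 0\<^sub>m i1 b @\<^sub>r 0\<^sub>m (a - i1) b"
    using \<alpha> UW dims(3) by (simp add: append_rows_zero_mult[of _ i1 i3] append_rows_zero_zero)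
  then have "\<alpha> * const_mat W = 0\<^sub>m i1 b"
    using \<alpha> UW by (subst (asm) append_rows_inj[of _ i1 b]) auto
  then have W: "W = 0\<^sub>m i3 b"
    using lin_indep_cols_mult_zero[OF \<alpha>(1,2) UW(3)] by simp
  have U\<beta>: "const_mat U * ?\<beta> = (const_mat P1 * \<beta>) @\<^sub>r (const_mat Z * \<beta>)"
    unfolding PZ(5) const_mat_four_block[OF PZ(1-4)]
    by (rule four_block_mult_append_rows_zero[of _ i1 j1 _ _ _ "a - i1"]) (use PZ \<beta> in auto)
  have c: "?\<alpha> * const_mat P3 \<in> carrier_mat a j3" "const_mat U * ?\<beta> \<in> carrier_mat a j3"
    using UW(1,4) \<alpha>c \<beta>c by auto
  have "?\<alpha> * const_mat P3 = const_mat U * ?\<beta>"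
    using UW(2) by (intro add_cancel_mat[OF _ c 2]) simp
  \<comment> \<open>Both sides are now stacked in the same way: the top rows are the relation
    between \<alpha> and \<beta>, the bottom rows say that \<beta> is annihilated by
    \<open>Z\<close>.\<close>
  then have "(\<alpha> * const_mat P3) @\<^sub>r 0\<^sub>m (a - i1) j3 = (const_mat P1 * \<beta>) @\<^sub>r (const_mat Z * \<beta>)"
    using \<alpha> UW by (simp add: append_rows_zero_mult[of _ i1 i3] U\<beta>)
  then have "\<alpha> * const_mat P3 = const_mat P1 * \<beta> \<and> 0\<^sub>m (a - i1) j3 = const_mat Z * \<beta>"
    using \<alpha>(1) \<beta>(1) UW(4) PZ(1,3)
    by (intro iffD1[OF append_rows_inj[of _ i1 j3 _ _ "a - i1"]]) simp_all
  then have eqs: "\<alpha> * const_mat P3 = const_mat P1 * \<beta>" "const_mat Z * \<beta> = 0\<^sub>m (a - i1) j3"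
    by (simp_all only:)
  have Z: "Z = 0\<^sub>m (a - i1) j1"
    using lin_indep_rows_mult_zero[OF \<beta>(1,2) PZ(3) eqs(2)] .
  have Peq: "P = four_block_mat (four_block_mat P1 P12 (0\<^sub>m (a - i1) j1) P2) P13 (0\<^sub>m i3 b) P3"
    by (simp only: UW(5) PZ(5) W Z)
  show ?thesis
    by (rule that[OF PZ(1) PZ(2)[unfolded b_def] PZ(4)[unfolded a_def b_def]
          UW(2)[unfolded a_def] UW(4) Peq[unfolded a_def b_def] eqs(1)])
qed

text \<open>The common reduction for all five families. An intertwiner and its inverse are both
  block triangular, so their extreme diagonal blocks are invertible and the block sizes match. For
  the converse diag(Q, I, R) conjugates one matrix into the other.\<close>

lemma Lambda_equivalent_iff:
  assumes \<alpha>: "\<alpha> \<in> carrier_mat i1 i3" "lin_indep_rows \<alpha>" "lin_indep_cols \<alpha>" "i1 + i3 \<le> m + 2"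
    and \<beta>: "\<beta> \<in> carrier_mat j1 j3" "lin_indep_rows \<beta>" "lin_indep_cols \<beta>" "j1 + j3 \<le> m + 2"
  shows "equivalent (m + 2) (Lambda m i1 i3 \<alpha>) (Lambda m j1 j3 \<beta>) \<longleftrightarrow>
    i1 = j1 \<and> i3 = j3 \<and> (\<exists>Q \<in> GL i1. \<exists>R \<in> GL i3. \<alpha> * const_mat R = const_mat Q * \<beta>)"
    (is "?E \<longleftrightarrow> ?R")
proof
  let ?n = "m + 2" and ?A = "Lambda m i1 i3 \<alpha>" and ?B = "Lambda m j1 j3 \<beta>"
  note A = Lambda_carrier[OF \<alpha>(1,4)] and B = Lambda_carrier[OF \<beta>(1,4)]
  assume ?E
  then obtain P P' where P: "P \<in> carrier_mat ?n ?n" "P' \<in> carrier_mat ?n ?n"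
    and inv: "P * P' = 1\<^sub>m ?n" "P' * P = 1\<^sub>m ?n"
    and eq: "const_mat P' * ?A * const_mat P = ?B"
    unfolding equivalent_def by (auto simp: GL_def inverts_mat_def)
  have cinv: "const_mat P * const_mat P' = 1\<^sub>m ?n"
    using const_mat_mult[OF P] inv by simp
  have c: "const_mat P \<in> carrier_mat ?n ?n" "const_mat P' \<in> carrier_mat ?n ?n"
    using P by auto
  have "const_mat P * ?B = const_mat P * (const_mat P' * (?A * const_mat P))"
    unfolding eq[symmetric] using assoc_mult_mat[OF c(2) A c(1)] by simp
  also have "\<dots> = (const_mat P * const_mat P') * (?A * const_mat P)"
    using A c by (intro assoc_mult_mat[symmetric, of _ ?n ?n _ ?n _ ?n]) auto
  also have "\<dots> = ?A * const_mat P" unfolding cinv using A c by auto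
  finally have e1: "?A * const_mat P = const_mat P * ?B" by simp
  have "?B * const_mat P' = const_mat P' * ?A * (const_mat P * const_mat P')"
    unfolding eq[symmetric] using A c by (intro assoc_mult_mat[of _ ?n ?n _ ?n _ ?n]) auto
  also have "\<dots> = const_mat P' * ?A" unfolding cinv using A c
    by (intro right_mult_one_mat) auto
  finally have e2: "?B * const_mat P' = const_mat P' * ?A" .
  obtain P1 P12 P2 P13 P3 where Pb:
    "P1 \<in> carrier_mat i1 j1" "P12 \<in> carrier_mat i1 (m + 2 - j3 - j1)"
    "P2 \<in> carrier_mat (m + 2 - i3 - i1) (m + 2 - j3 - j1)"
    "P13 \<in> carrier_mat (m + 2 - i3) j3" "P3 \<in> carrier_mat i3 j3"
    "P = four_block_mat (four_block_mat P1 P12 (0\<^sub>m (m + 2 - i3 - i1) j1) P2) P13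
           (0\<^sub>m i3 (m + 2 - j3)) P3"
    and QR: "\<alpha> * const_mat P3 = const_mat P1 * \<beta>"
    by (rule Lambda_intertwiner[OF \<alpha>(1,3,4) \<beta>(1,2,4) P(1) e1])
  obtain Q1 Q12 Q2 Q13 Q3 where Qb:
    "Q1 \<in> carrier_mat j1 i1" "Q12 \<in> carrier_mat j1 (m + 2 - i3 - i1)"
    "Q2 \<in> carrier_mat (m + 2 - j3 - j1) (m + 2 - i3 - i1)"
    "Q13 \<in> carrier_mat (m + 2 - j3) i3" "Q3 \<in> carrier_mat j3 i3"
    "P' = four_block_mat (four_block_mat Q1 Q12 (0\<^sub>m (m + 2 - j3 - j1) i1) Q2) Q13
           (0\<^sub>m j3 (m + 2 - i3)) Q3"
    by (rule Lambda_intertwiner[OF \<beta>(1,3,4) \<alpha>(1,2,4) P(2) e2])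
  have dims: "i1 + (m + 2 - i3 - i1) = m + 2 - i3" "j1 + (m + 2 - j3 - j1) = m + 2 - j3"
    "m + 2 - i3 + i3 = m + 2" "m + 2 - j3 + j3 = m + 2"
    using \<alpha>(4) \<beta>(4) by auto
  have cP: "four_block_mat P1 P12 (0\<^sub>m (m + 2 - i3 - i1) j1) P2 \<in> carrier_mat (m + 2 - i3) (m + 2 - j3)"
    using four_block_carrier_mat[OF Pb(1,3)] unfolding dims .
  have cQ: "four_block_mat Q1 Q12 (0\<^sub>m (m + 2 - j3 - j1) i1) Q2 \<in> carrier_mat (m + 2 - j3) (m + 2 - i3)"
    using four_block_carrier_mat[OF Qb(1,3)] unfolding dims .
  \<comment> \<open>First the splitting into sizes \<open>m + 2 - i3\<close> and \<open>i3\<close>: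
    it gives \<open>i3 = j3\<close>, the invertibility of \<open>P3\<close>, and that the two
    leading blocks are inverse to each other.\<close>
  note outer = GL_block_triangular_corners[OF cP Pb(4,5) cQ Qb(4,5) dims(3,4)
      inv[unfolded Pb(6) Qb(6)]]
  \<comment> \<open>The same argument inside the leading blocks, for the sizes \<open>i1\<close> and
    \<open>m + 2 - i3 - i1\<close>. It can start only now, since the equality of the two leading
    sizes comes from \<open>outer\<close>.\<close>
  note inner = GL_block_triangular_corners[OF Pb(1,2,3) Qb(1,2,3) dims(1) _ _ outer(5)]
  have d2: "j1 + (m + 2 - j3 - j1) = m + 2 - i3" using dims(2) outer(1) by simp
  note inner = inner[OF d2 outer(3)]
  have "P1 \<in> GL i1" using Pb(1) Qb(1) inner(1,3) by (intro GL_I[of _ _ Q1]) auto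
  moreover have "P3 \<in> GL i3" using Pb(5) Qb(5) outer(2,4) by (intro GL_I[of _ _ Q3]) auto
  ultimately show ?R using QR inner(1) outer(2) by blast
next
  let ?n = "m + 2"
  assume ?R
  then obtain Q R where j: "j1 = i1" "j3 = i3" and QR: "Q \<in> GL i1" "R \<in> GL i3"
    and eq: "\<alpha> * const_mat R = const_mat Q * \<beta>" by auto
  obtain Q' where Q': "Q' \<in> GL i1" "Q * Q' = 1\<^sub>m i1" "Q' * Q = 1\<^sub>m i1" using GL_inverse[OF QR(1)] .
  obtain R' where R': "R' \<in> GL i3" "R * R' = 1\<^sub>m i3" "R' * R = 1\<^sub>m i3" using GL_inverse[OF QR(2)] .
  note c = QR[THEN GL_carrier] Q'(1)[THEN GL_carrier] R'(1)[THEN GL_carrier]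
  define a d where "a = ?n - i3" and "d = ?n - i3 - i1"
  have dims: "i1 + d = a" "a + i3 = ?n" using \<alpha>(4) by (auto simp: a_def d_def)
  \<comment> \<open>\<open>D X Y\<close> is diag(X, I, Y) with a middle identity of size d, and
    \<open>U X\<close> is its leading part. Both are multiplicative, so \<open>D Q' R'\<close>
    inverts \<open>D Q R\<close>.\<close>
  define U where "U X = four_block_mat X (0\<^sub>m i1 d) (0\<^sub>m d i1) (1\<^sub>m d)" for X :: "'a mat"
  define D where "D X Y = four_block_mat (U X) (0\<^sub>m a i3) (0\<^sub>m i3 a) Y" for X Y :: "'a mat"
  have Uc: "U X \<in> carrier_mat a a" if "X \<in> carrier_mat i1 i1" for X
    using that dims(1) unfolding U_def by (auto intro!: carrier_matI)
  have Dc: "D X Y \<in> carrier_mat ?n ?n" if "X \<in> carrier_mat i1 i1" "Y \<in> carrier_mat i3 i3" for X Y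
    using that Uc[OF that(1)] dims unfolding D_def by (auto intro!: carrier_matI)
  have Um: "U X * U X' = U (X * X')" if "X \<in> carrier_mat i1 i1" "X' \<in> carrier_mat i1 i1" for X X'
    unfolding U_def
    by (subst mult_four_block_mat[of _ i1 i1 _ d _ d _ _ i1 _ d]) (use that in auto)
  have Dm: "D X Y * D X' Y' = D (X * X') (Y * Y')"
    if "X \<in> carrier_mat i1 i1" "X' \<in> carrier_mat i1 i1" "Y \<in> carrier_mat i3 i3" "Y' \<in> carrier_mat i3 i3"
    for X X' Y Y'
    unfolding D_def Um[OF that(1,2), symmetric]
    by (subst mult_four_block_mat[of _ a a _ i3 _ i3 _ _ a _ i3])
      (use that Uc[OF that(1)] Uc[OF that(2)] in auto)
  have D1: "D (1\<^sub>m i1) (1\<^sub>m i3) = 1\<^sub>m ?n"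
    unfolding D_def U_def by (simp only: four_block_one_mat dims)
  have inv: "D Q R * D Q' R' = 1\<^sub>m ?n" "D Q' R' * D Q R = 1\<^sub>m ?n"
    using Dm c Q' R' D1 by simp_all
  let ?\<alpha> = "\<alpha> @\<^sub>r 0\<^sub>m d i3" and ?\<beta> = "\<beta> @\<^sub>r 0\<^sub>m d i3"
  have \<alpha>c: "?\<alpha> \<in> carrier_mat a i3"
    using carrier_append_rows[OF \<alpha>(1) zero_carrier_mat, of d] unfolding dims .
  have \<beta>c: "?\<beta> \<in> carrier_mat a i3"
    using carrier_append_rows[OF \<beta>(1) zero_carrier_mat, of d] unfolding j dims .
  have A: "Lambda m i1 i3 \<alpha> = four_block_mat (1\<^sub>m a) ?\<alpha> (0\<^sub>m i3 a) (1\<^sub>m i3)"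
    unfolding a_def d_def by (rule Lambda_eq_four_block[OF \<alpha>(4)])
  have B: "Lambda m i1 i3 \<beta> = four_block_mat (1\<^sub>m a) ?\<beta> (0\<^sub>m i3 a) (1\<^sub>m i3)"
    unfolding a_def d_def by (rule Lambda_eq_four_block[OF \<alpha>(4)])
  have cD: "const_mat (D X Y) = four_block_mat (const_mat (U X)) (0\<^sub>m a i3) (0\<^sub>m i3 a) (const_mat Y)"
    if "X \<in> carrier_mat i1 i1" "Y \<in> carrier_mat i3 i3" for X Y
    unfolding D_def
    by (subst const_mat_four_block[of _ a a _ i3 _ i3]) (use that Uc[OF that(1)] in auto)
  \<comment> \<open>The relation \<alpha> R = Q \<beta>, padded by zero rows, is precisely the
    equality of the upper right blocks in the intertwining equation.\<close>
  have "const_mat (U Q) * ?\<beta> = (const_mat Q * \<beta>) @\<^sub>r 0\<^sub>m d i3"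
    unfolding U_def using c \<beta> j
    by (subst const_mat_four_block[of _ i1 i1 _ d _ d];
        (subst four_block_mult_append_rows_zero[of _ i1 i1 _ _ _ d])?) auto
  also have "\<dots> = ?\<alpha> * const_mat R"
    unfolding eq[symmetric] using \<alpha> c by (subst append_rows_zero_mult[of _ i1 i3]) auto
  finally have e: "const_mat (U Q) * ?\<beta> = ?\<alpha> * const_mat R" .
  have "Lambda m i1 i3 \<alpha> * const_mat (D Q R) =
      four_block_mat (const_mat (U Q)) (?\<alpha> * const_mat R) (0\<^sub>m i3 a) (const_mat R)"
    unfolding A cD[OF c(1,2)]
    by (subst mult_four_block_mat[of _ a a _ i3 _ i3 _ _ a _ i3]) (use \<alpha>c c Uc[OF c(1)] in auto)
  also have "\<dots> = const_mat (D Q R) * Lambda m i1 i3 \<beta>"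
    unfolding B cD[OF c(1,2)] e[symmetric]
    by (subst mult_four_block_mat[of _ a a _ i3 _ i3 _ _ a _ i3]) (use \<beta>c c Uc[OF c(1)] in auto)
  finally have PB: "Lambda m i1 i3 \<alpha> * const_mat (D Q R) = const_mat (D Q R) * Lambda m i1 i3 \<beta>" .
  note D = Dc[OF c(1,2)] Dc[OF c(3,4)]
  note AB = Lambda_carrier[OF \<alpha>(1,4)] Lambda_carrier[OF \<beta>(1,4)]
  have "const_mat (D Q' R') * Lambda m i1 i3 \<alpha> * const_mat (D Q R) =
      const_mat (D Q' R') * (const_mat (D Q R) * Lambda m i1 i3 \<beta>)"
    unfolding PB[symmetric] using D AB by (intro assoc_mult_mat[of _ ?n ?n _ ?n _ ?n]) auto
  also have "\<dots> = const_mat (D Q' R') * const_mat (D Q R) * Lambda m i1 i3 \<beta>"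
    using D AB j by (intro assoc_mult_mat[symmetric, of _ ?n ?n _ ?n _ ?n]) auto
  also have "\<dots> = Lambda m i1 i3 \<beta>"
    unfolding const_mat_mult[OF D(2,1), symmetric] inv(2) const_mat_one
    by (rule left_mult_one_mat[OF AB(2)[unfolded j]])
  finally have fin: "const_mat (D Q' R') * Lambda m i1 i3 \<alpha> * const_mat (D Q R) = Lambda m i1 i3 \<beta>" .
  have "D Q R \<in> GL ?n" "D Q' R' \<in> GL ?n"
    using GL_I[OF D inv(1)] GL_I[OF D(2,1) inv(2)] by auto
  then show ?E unfolding equivalent_def j using fin inv D
    by (intro bexI[of _ "D Q R"] bexI[of _ "D Q' R'"]) (auto simp: inverts_mat_def)
qed

section \<open>Determinant criteria for invertibility\<close>

text \<open>A nonzero determinant yields the inverse as the adjugate divided by the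
  determinant.\<close>

lemma GL_iff_det: "(g :: 'k::field mat) \<in> GL n \<longleftrightarrow> g \<in> carrier_mat n n \<and> det g \<noteq> 0"
proof
  assume g: "g \<in> GL n"
  then obtain h where h: "h \<in> GL n" "g * h = 1\<^sub>m n" using GL_inverse by metis
  have "det g * det h = 1"
    using det_mult[OF GL_carrier[OF g] GL_carrier[OF h(1)]] h(2) by simp
  then show "g \<in> carrier_mat n n \<and> det g \<noteq> 0" using GL_carrier[OF g] by auto
next
  assume g: "g \<in> carrier_mat n n \<and> det g \<noteq> 0"
  then have c: "g \<in> carrier_mat n n" by simp
  note adj = adj_mat[OF c]
  have "g * (inverse (det g) \<cdot>\<^sub>m adj_mat g) = inverse (det g) \<cdot>\<^sub>m (g * adj_mat g)"
    by (rule mult_smult_distrib[OF c adj(1)])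
  also have "\<dots> = 1\<^sub>m n" unfolding adj(2) using g by (intro eq_matI) auto
  finally have "g * (inverse (det g) \<cdot>\<^sub>m adj_mat g) = 1\<^sub>m n" .
  then show "g \<in> GL n" by (intro GL_I[OF c smult_carrier_mat[OF adj(1)]])
qed

lemma GL_four_block_upper:
  fixes A :: "'k::field mat"
  assumes "A \<in> carrier_mat n n" "B \<in> carrier_mat n m" "D \<in> carrier_mat m m"
  shows "four_block_mat A B (0\<^sub>m m n) D \<in> GL (n + m) \<longleftrightarrow> A \<in> GL n \<and> D \<in> GL m"
  using det_four_block_mat_lower_left_zero[OF assms(1,2) refl assms(3)] assms
  by (simp add: GL_iff_det)

subsection \<open>Independent families and the matrices \<open>L(a | b | c)\<close>\<close>

lemma poly_row_carrier [simp]: "poly_row fs \<in> carrier_mat n m \<longleftrightarrow> n = 1 \<and> m = length fs"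
  using mat_of_row_carrier(1)[OF carrier_vecI[of "vec_of_list fs" "length fs"]]
  unfolding poly_row_def by auto

lemma dim_poly_row [simp]: "dim_row (poly_row fs) = 1" "dim_col (poly_row fs) = length fs"
  by (simp_all add: poly_row_def)

lemma index_poly_row [simp]: "t < length fs \<Longrightarrow> poly_row fs $$ (0, t) = fs ! t"
  by (simp add: poly_row_def vec_of_list_index)

text \<open>Independence is defined on the underlying set, while the computations produce
  coefficients indexed by positions. Distinctness makes the two indexings equivalent.\<close>

lemma lin_indep_sum_zero:
  assumes "lin_indep fs" "(\<Sum>t<length fs. smult (c t) (fs ! t)) = 0" "t < length fs"
  shows "c t = 0"
proof -
  have inj: "inj_on ((!) fs) {..<length fs}"
    using assms(1) by (intro inj_on_nth) (auto simp: lin_indep_def)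
  have set: "set fs = (!) fs ` {..<length fs}"
    by (auto simp: in_set_conv_nth)
  \<comment> \<open>The coefficient of a vector is read off at its unique position in the
    list.\<close>
  define u where "u v = c (inv_into {..<length fs} ((!) fs) v)" for v
  have u: "u (fs ! s) = c s" if "s < length fs" for s
    using inj that by (simp add: u_def)
  have "(\<Sum>v\<in>set fs. smult (u v) v) = (\<Sum>s<length fs. smult (u (fs ! s)) (fs ! s))"
    unfolding set by (subst sum.reindex[OF inj]) simp
  also have "\<dots> = 0" using assms(2) by (simp add: u)
  finally have "\<forall>v\<in>set fs. u v = 0"
    using assms(1) by (auto simp: lin_indep_def poly_vs.dependent_finite)
  then show ?thesis using u[OF assms(3)] assms(3) by auto
qed

lemma lin_indep_nth_nonzero: "lin_indep fs \<Longrightarrow> t < length fs \<Longrightarrow> fs ! t \<noteq> 0"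
  by (metis lin_indep_def nth_mem poly_vs.dependent_zero)

lemma lin_indep_two:
  assumes "lin_indep fs" "s < length fs" "t < length fs" "s \<noteq> t"
    "smult c (fs ! s) = smult d (fs ! t)"
  shows "c = 0"
proof -
  \<comment> \<open>The equation is moved to one side as a relation supported at the two positions s
    and t.\<close>
  let ?u = "\<lambda>r. if r = s then c else if r = t then - d else 0"
  have "(\<Sum>r<length fs. smult (?u r) (fs ! r)) = (\<Sum>r\<in>{s, t}. smult (?u r) (fs ! r))"
    using assms by (intro sum.mono_neutral_right) auto
  also have "\<dots> = 0" using assms by simp
  finally have "(\<Sum>r<length fs. smult (?u r) (fs ! r)) = 0" .
  from lin_indep_sum_zero[OF assms(1) this] show "c = 0"
    using assms(2) by (metis (full_types))
qed

text \<open>A repeated entry or an entry in the span of the others would leave a spanning set with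
  fewer elements than the dimension.\<close>

lemma lin_indep_of_dim:
  assumes "poly_vs.dim (poly_vs.span (set fs)) = length fs"
  shows "lin_indep fs"
proof -
  have "length fs \<le> card (set fs)"
    using poly_vs.dim_le_card[of "poly_vs.span (set fs)" "set fs"] assms by simp
  then have card: "card (set fs) = length fs" using card_length[of fs] by simp
  moreover have "poly_vs.independent (set fs)"
  proof (rule ccontr)
    assume "\<not> ?thesis"
    then obtain x where x: "x \<in> set fs" "x \<in> poly_vs.span (set fs - {x})"
      by (auto simp: poly_vs.dependent_def)
    have "insert x (set fs - {x}) = set fs" using x by auto
    with poly_vs.span_redundant[OF x(2)] have "poly_vs.span (set fs) = poly_vs.span (set fs - {x})"
      by simp
    then have "length fs \<le> card (set fs - {x})"
      using poly_vs.dim_le_card[of "poly_vs.span (set fs)" "set fs - {x}"] assms by simp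
    moreover have "card (set fs - {x}) < card (set fs)"
      by (rule psubset_card_mono) (use x(1) in auto)
    ultimately show False using card by simp
  qed
  ultimately show ?thesis by (simp add: lin_indep_def card_distinct)
qed

lemma Lmat_carrier [simp]:
  "Lmat as bs a \<in> carrier_mat n m \<longleftrightarrow> n = length bs + 1 \<and> m = length as + 1"
  using mat_carrier[of "length bs + 1" "length as + 1"] unfolding Lmat_def by auto

lemma dim_Lmat [simp]:
  "dim_row (Lmat as bs a) = length bs + 1" "dim_col (Lmat as bs a) = length as + 1"
  by (simp_all add: Lmat_def)

lemma index_Lmat:
  "s < length as \<Longrightarrow> Lmat as bs a $$ (0, s) = as ! s"
  "Lmat as bs a $$ (0, length as) = a"
  "t < length bs \<Longrightarrow> s < length as \<Longrightarrow> Lmat as bs a $$ (Suc t, s) = 0"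
  "t < length bs \<Longrightarrow> Lmat as bs a $$ (Suc t, length as) = bs ! t"
  by (simp_all add: Lmat_def nth_append)

lemma Lmat_inj:
  assumes "Lmat as bs a = Lmat cs ds c"
  shows "as = cs" "bs = ds" "a = c"
proof -
  have len: "length as = length cs" "length bs = length ds"
    using arg_cong[OF assms, of dim_col] arg_cong[OF assms, of dim_row] by simp_all
  show "as = cs"
    using len index_Lmat(1)[of _ as bs a] index_Lmat(1)[of _ cs ds c] assms
    by (intro nth_equalityI) auto
  show "bs = ds"
    using len index_Lmat(4)[of _ bs as a] index_Lmat(4)[of _ ds cs c] assms
    by (intro nth_equalityI) auto
  show "a = c" using index_Lmat(2)[of as bs a] index_Lmat(2)[of cs ds c] assms len by simp
qed

text \<open>\<open>frakL\<close> only provides some presentation by independent families; the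
  entries of the matrix determine the presentation, so the given families are those.\<close>

lemma Lmat_frakL:
  assumes "Lmat as bs a \<in> frakL i j"
  shows "lin_indep as" "lin_indep bs"
proof -
  obtain cs ds c where eq: "Lmat as bs a = Lmat cs ds c" and ind: "lin_indep cs" "lin_indep ds"
    using assms by (auto simp: frakL_def)
  show "lin_indep as" "lin_indep bs" using Lmat_inj[OF eq] ind by simp_all
qed

text \<open>A row of \<open>L\<close> below the first has a single possibly nonzero entry, the last
  one. Hence it meets only the last row of \<open>R\<close>.\<close>

lemma Lmat_mult_const_index:
  fixes R :: "'k::field mat"
  assumes "R \<in> carrier_mat (length as + 1) n" "s < n"
  shows "(Lmat as bs a * const_mat R) $$ (0, s) =
      (\<Sum>u<length as. smult (R $$ (u, s)) (as ! u)) + smult (R $$ (length as, s)) a"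
    "t < length bs \<Longrightarrow> (Lmat as bs a * const_mat R) $$ (Suc t, s) = smult (R $$ (length as, s)) (bs ! t)"
proof -
  let ?L = "Lmat as bs a"
  have *: "(?L * const_mat R) $$ (t, s) =
      (\<Sum>u<length as. ?L $$ (t, u) * [:R $$ (u, s):]) + ?L $$ (t, length as) * [:R $$ (length as, s):]"
    if "t < length bs + 1" for t
    using assms that by (simp add: scalar_prod_def atLeast0LessThan)
  show "(?L * const_mat R) $$ (0, s) =
      (\<Sum>u<length as. smult (R $$ (u, s)) (as ! u)) + smult (R $$ (length as, s)) a"
    by (subst *) (simp_all add: index_Lmat)
  show "(?L * const_mat R) $$ (Suc t, s) = smult (R $$ (length as, s)) (bs ! t)"
    if "t < length bs"
    using that by (subst *) (simp_all add: index_Lmat)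
qed

text \<open>A column of \<open>L\<close> before the last is supported in the first row and so meets
  only the first column of \<open>Q\<close>. Splitting off the summand of index 0 leads to the
  shifted indices \<open>Suc u\<close>.\<close>

lemma const_mult_Lmat_index:
  fixes Q :: "'k::field mat"
  assumes "Q \<in> carrier_mat n (length bs + 1)" "t < n"
  shows "s < length as \<Longrightarrow> (const_mat Q * Lmat as bs a) $$ (t, s) = smult (Q $$ (t, 0)) (as ! s)"
    "(const_mat Q * Lmat as bs a) $$ (t, length as) =
      smult (Q $$ (t, 0)) a + (\<Sum>u<length bs. smult (Q $$ (t, Suc u)) (bs ! u))"
proof -
  let ?L = "Lmat as bs a"
  have *: "(const_mat Q * ?L) $$ (t, s) =
      [:Q $$ (t, 0):] * ?L $$ (0, s) + (\<Sum>u<length bs. [:Q $$ (t, Suc u):] * ?L $$ (Suc u, s))"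
    if "s < length as + 1" for s
  proof -
    have "(const_mat Q * ?L) $$ (t, s) = (\<Sum>u<Suc (length bs). [:Q $$ (t, u):] * ?L $$ (u, s))"
      using assms that by (simp add: scalar_prod_def atLeast0LessThan del: sum.lessThan_Suc)
    then show ?thesis by (simp only: sum.lessThan_Suc_shift)
  qed
  show "(const_mat Q * ?L) $$ (t, s) = smult (Q $$ (t, 0)) (as ! s)" if "s < length as"
    using that by (subst *) (simp_all add: index_Lmat)
  show "(const_mat Q * ?L) $$ (t, length as) =
      smult (Q $$ (t, 0)) a + (\<Sum>u<length bs. smult (Q $$ (t, Suc u)) (bs ! u))"
    by (subst *) (simp_all add: index_Lmat)
qed

text \<open>In a relation among the columns, the second row leaves only the last coefficient times
  the nonzero \<open>bs ! 0\<close>, so this coefficient vanishes. The first row is then a relation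
  among \<open>as\<close>.\<close>

lemma Lmat_lin_indep_cols:
  assumes "lin_indep as" "lin_indep bs" "bs \<noteq> []"
  shows "lin_indep_cols (Lmat as bs a)"
  unfolding lin_indep_cols_def
proof (intro ballI impI)
  let ?i = "length as"
  fix c assume c: "c \<in> carrier_vec (dim_col (Lmat as bs a))"
    and z: "Lmat as bs a *\<^sub>v map_vec (\<lambda>x. [:x:]) c = 0\<^sub>v (dim_row (Lmat as bs a))"
  \<comment> \<open>The coefficient vector is recast as a one-column matrix so that the entry
    formulas for products with \<open>L\<close> apply.\<close>
  define X where "X = mat (?i + 1) 1 (\<lambda>(r, _). c $ r)"
  have X: "X \<in> carrier_mat (?i + 1) 1" by (simp add: X_def)
  have "col (const_mat X) 0 = map_vec (\<lambda>x. [:x:]) c"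
    using c by (intro eq_vecI) (auto simp: X_def)
  then have zr: "(Lmat as bs a * const_mat X) $$ (r, 0) = 0" if "r < length bs + 1" for r
    using arg_cong[OF z, of "\<lambda>v. v $ r"] that X by simp
  have "smult (X $$ (?i, 0)) (bs ! 0) = 0"
    using zr[of "Suc 0"] Lmat_mult_const_index(2)[OF X, of 0 0 bs a] assms(3) by simp
  then have last: "X $$ (?i, 0) = 0"
    using lin_indep_nth_nonzero[OF assms(2), of 0] assms(3) by simp
  have "(\<Sum>u<?i. smult (X $$ (u, 0)) (as ! u)) = 0"
    using zr[of 0] Lmat_mult_const_index(1)[OF X, of 0 bs a] last by simp
  then have "X $$ (u, 0) = 0" if "u < ?i" for u
    using lin_indep_sum_zero[OF assms(1), of "\<lambda>u. X $$ (u, 0)"] that by simp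
  with last have "X $$ (u, 0) = 0" if "u < ?i + 1" for u
    using that by (cases "u = ?i") auto
  then show "c = 0\<^sub>v (dim_col (Lmat as bs a))"
    using c by (intro eq_vecI) (auto simp: X_def)
qed

text \<open>Dually, the first column kills the first coefficient because \<open>as ! 0\<close> is
  nonzero, and the last column is then a relation among \<open>bs\<close>.\<close>

lemma Lmat_lin_indep_rows:
  assumes "lin_indep as" "lin_indep bs" "as \<noteq> []"
  shows "lin_indep_rows (Lmat as bs a)"
  unfolding lin_indep_rows_def lin_indep_cols_def
proof (intro ballI impI)
  let ?L = "Lmat as bs a" and ?j = "length bs"
  fix c assume c: "c \<in> carrier_vec (dim_col (transpose_mat ?L))"
    and z: "transpose_mat ?L *\<^sub>v map_vec (\<lambda>x. [:x:]) c = 0\<^sub>v (dim_row (transpose_mat ?L))"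
  define X where "X = mat 1 (?j + 1) (\<lambda>(_, r). c $ r)"
  have X: "X \<in> carrier_mat 1 (?j + 1)" by (simp add: X_def)
  have row: "row (const_mat X) 0 = map_vec (\<lambda>x. [:x:]) c"
    using c by (intro eq_vecI) (auto simp: X_def)
  have zs: "(const_mat X * ?L) $$ (0, s) = 0" if "s < length as + 1" for s
    using arg_cong[OF z, of "\<lambda>v. v $ s"] that X c
    by (simp add: row comm_scalar_prod[of _ "Suc ?j"])
  have "smult (X $$ (0, 0)) (as ! 0) = 0"
    using zs[of 0] const_mult_Lmat_index(1)[OF X, of 0 0 as a] assms(3) by simp
  then have first: "X $$ (0, 0) = 0"
    using lin_indep_nth_nonzero[OF assms(1), of 0] assms(3) by simp
  have "(\<Sum>u<?j. smult (X $$ (0, Suc u)) (bs ! u)) = 0"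
    using zs[of "length as"] const_mult_Lmat_index(2)[OF X, of 0 as a] first by simp
  then have "X $$ (0, Suc u) = 0" if "u < ?j" for u
    using lin_indep_sum_zero[OF assms(2), of "\<lambda>u. X $$ (0, Suc u)"] that by simp
  with first have "X $$ (0, u) = 0" if "u < ?j + 1" for u
    using that by (cases u) auto
  then show "c = 0\<^sub>v (dim_col (transpose_mat ?L))"
    using c by (intro eq_vecI) (auto simp: X_def)
qed

subsection \<open>The action of \<open>V(i, j, 1; k)\<close>\<close>

text \<open>The horizontal counterpart of \<open>append_rows\<close>, written with empty lower
  blocks so that the rule for multiplying block matrices covers it.\<close>

definition append_cols :: "'a::zero mat \<Rightarrow> 'a mat \<Rightarrow> 'a mat" where
  "append_cols A B = four_block_mat A B (0\<^sub>m 0 (dim_col A)) (0\<^sub>m 0 (dim_col B))"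

lemma append_cols_carrier [simp]:
  "A \<in> carrier_mat n c \<Longrightarrow> B \<in> carrier_mat n d \<Longrightarrow> append_cols A B \<in> carrier_mat n (c + d)"
  by (auto simp: append_cols_def intro!: carrier_matI)

lemma append_cols_inj:
  assumes "A \<in> carrier_mat n c" "B \<in> carrier_mat n d" "A' \<in> carrier_mat n c" "B' \<in> carrier_mat n d"
  shows "append_cols A B = append_cols A' B' \<longleftrightarrow> A = A' \<and> B = B'"
proof -
  have "dim_col A = dim_col A'" "dim_col B = dim_col B'" using assms by auto
  then show ?thesis unfolding append_cols_def
    by (subst four_block_mat_inj[of _ n c _ d _ 0]) (use assms in simp_all)
qed

lemma append_cols_mult_four_block:
  fixes A :: "'a::comm_ring_1 mat"
  assumes "A \<in> carrier_mat n c1" "B \<in> carrier_mat n c2" "C \<in> carrier_mat c1 d1" "D \<in> carrier_mat c1 d2"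
    "E \<in> carrier_mat c2 d1" "F \<in> carrier_mat c2 d2"
  shows "append_cols A B * four_block_mat C D E F = append_cols (A * C + B * E) (A * D + B * F)"
  unfolding append_cols_def
  by (subst mult_four_block_mat[of _ n c1 _ c2 _ 0 _ _ d1 _ d2]) (use assms in simp_all)

lemma append_cols_mult_append_rows:
  fixes A :: "'a::comm_ring_1 mat"
  assumes "A \<in> carrier_mat n c1" "B \<in> carrier_mat n c2" "X \<in> carrier_mat c1 d" "Y \<in> carrier_mat c2 d"
  shows "append_cols A B * (X @\<^sub>r Y) = A * X + B * Y"
proof -
  have "append_cols A B * (X @\<^sub>r Y) = append_cols (A * X + B * Y) (0\<^sub>m n 0)"
    unfolding append_rows_def
    by (subst append_cols_mult_four_block[of _ n c1 _ c2 _ d _ 0]) (use assms in simp_all)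
  also have "\<dots> = A * X + B * Y"
    unfolding append_cols_def by (rule eq_matI) (use assms in simp_all)
  finally show ?thesis .
qed

lemma const_mat_append_rows:
  assumes "X \<in> carrier_mat r n" "Y \<in> carrier_mat s n"
  shows "const_mat (X @\<^sub>r Y) = const_mat X @\<^sub>r const_mat Y"
  unfolding append_rows_def
  by (subst const_mat_four_block[of _ r n _ 0 _ s]) (use assms in simp_all)

lemma const_mat_smult: "const_mat (c \<cdot>\<^sub>m A) = [:c:] \<cdot>\<^sub>m const_mat A"
  by (rule eq_matI) simp_all

lemma mult_const_smult:
  assumes "A \<in> carrier_mat n m" "X \<in> carrier_mat m l"
  shows "A * const_mat (c \<cdot>\<^sub>m X) = [:c:] \<cdot>\<^sub>m (A * const_mat X)"
  unfolding const_mat_smult by (rule mult_smult_distrib[of _ n m _ l]) (use assms in simp_all)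

lemma poly_row_append: "poly_row (xs @ ys) = append_cols (poly_row xs) (poly_row ys)"
proof (rule eq_matI)
  fix r s assume "r < dim_row (append_cols (poly_row xs) (poly_row ys))"
    "s < dim_col (append_cols (poly_row xs) (poly_row ys))"
  then have "r = 0" "s < length xs + length ys" by (simp_all add: append_cols_def)
  then show "poly_row (xs @ ys) $$ (r, s) = append_cols (poly_row xs) (poly_row ys) $$ (r, s)"
    by (simp add: append_cols_def nth_append)
qed (simp_all add: append_cols_def)

text \<open>Grouping the row as (as, as' | a) matches the nested blocks of an element of
  \<open>V\<close>. The action thus acts separately on the first two families, while the last entry
  may also absorb combinations of them.\<close>

lemma poly_row_mult_V:
  assumes len: "length as = i" "length as' = j" "length bs = i" "length bs' = j"
    and g: "g11 \<in> carrier_mat i i" "g22 \<in> carrier_mat j j" "g33 \<in> carrier_mat 1 1"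
      "g13 \<in> carrier_mat i 1" "g23 \<in> carrier_mat j 1"
  shows "poly_row (bs @ bs' @ [b]) = poly_row (as @ as' @ [a]) *
      const_mat (four_block_mat (four_block_mat g11 (0\<^sub>m i j) (0\<^sub>m j i) g22) (g13 @\<^sub>r g23)
        (0\<^sub>m 1 (i + j)) g33) \<longleftrightarrow>
    poly_row bs = poly_row as * const_mat g11 \<and>
    poly_row bs' = poly_row as' * const_mat g22 \<and>
    poly_row [b] = poly_row as * const_mat g13 + poly_row as' * const_mat g23 +
      poly_row [a] * const_mat g33"
proof -
  let ?A = "poly_row as" and ?A' = "poly_row as'"
  have c: "?A \<in> carrier_mat 1 i" "?A' \<in> carrier_mat 1 j" "poly_row [a] \<in> carrier_mat 1 1"
    "poly_row bs \<in> carrier_mat 1 i" "poly_row bs' \<in> carrier_mat 1 j" "poly_row [b] \<in> carrier_mat 1 1"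
    using len by simp_all
  have AA: "append_cols ?A ?A' \<in> carrier_mat 1 (i + j)" using c by simp
  let ?D = "four_block_mat (const_mat g11) (0\<^sub>m i j) (0\<^sub>m j i) (const_mat g22)"
    and ?G = "const_mat g13 @\<^sub>r const_mat g23"
  have D: "?D \<in> carrier_mat (i + j) (i + j)"
    by (rule four_block_carrier_mat) (use g in simp_all)
  have G: "?G \<in> carrier_mat (i + j) 1"
    by (rule carrier_append_rows) (use g in simp_all)
  have DD: "append_cols ?A ?A' * ?D = append_cols (?A * const_mat g11) (?A' * const_mat g22)"
    by (subst append_cols_mult_four_block[of _ 1 i _ j _ i _ j]) (use c g in simp_all)
  have GG: "append_cols ?A ?A' * ?G = ?A * const_mat g13 + ?A' * const_mat g23"
    by (rule append_cols_mult_append_rows[of _ 1 i _ j _ 1]) (use c g in simp_all)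
  have DDc: "append_cols (?A * const_mat g11) (?A' * const_mat g22) \<in> carrier_mat 1 (i + j)"
    by (rule append_cols_carrier) (use c g in simp_all)
  have g33: "const_mat g33 \<in> carrier_mat 1 1" using g(3) by simp
  have D': "four_block_mat g11 (0\<^sub>m i j) (0\<^sub>m j i) g22 \<in> carrier_mat (i + j) (i + j)"
    by (rule four_block_carrier_mat) (use g in simp_all)
  have G': "g13 @\<^sub>r g23 \<in> carrier_mat (i + j) 1"
    by (rule carrier_append_rows) (use g in simp_all)
  have cg: "const_mat (four_block_mat (four_block_mat g11 (0\<^sub>m i j) (0\<^sub>m j i) g22) (g13 @\<^sub>r g23)
        (0\<^sub>m 1 (i + j)) g33) = four_block_mat ?D ?G (0\<^sub>m 1 (i + j)) (const_mat g33)"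
    unfolding const_mat_four_block[OF D' G' zero_carrier_mat g(3)]
      const_mat_four_block[OF g(1) zero_carrier_mat zero_carrier_mat g(2)]
      const_mat_append_rows[OF g(4,5)] const_mat_zero ..
  have "append_cols (append_cols ?A ?A') (poly_row [a]) * four_block_mat ?D ?G (0\<^sub>m 1 (i + j)) (const_mat g33) =
     append_cols (append_cols (?A * const_mat g11) (?A' * const_mat g22))
       (?A * const_mat g13 + ?A' * const_mat g23 + poly_row [a] * const_mat g33)"
    unfolding append_cols_mult_four_block[OF AA c(3) D G zero_carrier_mat g33] DD GG
      right_mult_zero_mat[OF c(3)] right_add_zero_mat[OF DDc] ..
  then have "poly_row (as @ as' @ [a]) *
      const_mat (four_block_mat (four_block_mat g11 (0\<^sub>m i j) (0\<^sub>m j i) g22) (g13 @\<^sub>r g23)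
        (0\<^sub>m 1 (i + j)) g33) =
     append_cols (append_cols (?A * const_mat g11) (?A' * const_mat g22))
       (?A * const_mat g13 + ?A' * const_mat g23 + poly_row [a] * const_mat g33)"
    unfolding cg append_assoc[symmetric] poly_row_append .
  moreover have "poly_row (bs @ bs' @ [b]) =
      append_cols (append_cols (poly_row bs) (poly_row bs')) (poly_row [b])"
    unfolding append_assoc[symmetric] poly_row_append ..
  ultimately show ?thesis
    using c g by (simp add: append_cols_inj[of _ 1 "i + j" _ 1] append_cols_inj[of _ 1 i _ j])
qed

text \<open>The one-by-one block \<open>poly_row [a]\<close> is the corner of \<open>L\<close>; with
  the zero block exposed, products with block triangular matrices can be read off.\<close>

lemma Lmat_four_block:
  "Lmat as bs a = four_block_mat (poly_row as) (poly_row [a]) (0\<^sub>m (length bs) (length as))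
     (transpose_mat (poly_row bs))"
proof (rule eq_matI)
  let ?F = "four_block_mat (poly_row as) (poly_row [a]) (0\<^sub>m (length bs) (length as))
     (transpose_mat (poly_row bs))"
  fix r s assume "r < dim_row ?F" "s < dim_col ?F"
  then have "r < Suc (length bs)" "s < Suc (length as)" by simp_all
  then show "Lmat as bs a $$ (r, s) = ?F $$ (r, s)"
    by (cases r; cases "s = length as") (simp_all add: index_Lmat)
qed simp_all

text \<open>For block upper triangular \<open>R\<close> and \<open>Q\<close> the lower left blocks
  of both products are zero, and the other three give the three equations. The transposes arise
  because \<open>as'\<close> and \<open>bs'\<close> stand in a column of \<open>L\<close> but in a
  row for the action of \<open>V\<close>.\<close>

lemma Lmat_intertwine_iff:
  fixes R11 :: "'k::field mat"
  assumes len: "length as = i" "length as' = j" "length bs = i" "length bs' = j"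
    and R: "R11 \<in> carrier_mat i i" "R12 \<in> carrier_mat i 1"
    and Q: "Q12 \<in> carrier_mat 1 j" "Q22 \<in> carrier_mat j j"
  shows "Lmat as as' a * const_mat (four_block_mat R11 R12 (0\<^sub>m 1 i) (r \<cdot>\<^sub>m 1\<^sub>m 1)) =
      const_mat (four_block_mat (q \<cdot>\<^sub>m 1\<^sub>m 1) Q12 (0\<^sub>m j 1) Q22) * Lmat bs bs' b \<longleftrightarrow>
    poly_row as * const_mat R11 = [:q:] \<cdot>\<^sub>m poly_row bs \<and>
    (poly_row as * const_mat R12) $$ (0, 0) + smult r a =
      smult q b + (poly_row bs' * const_mat (transpose_mat Q12)) $$ (0, 0) \<and>
    [:r:] \<cdot>\<^sub>m poly_row as' = poly_row bs' * const_mat (transpose_mat Q22)"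
proof -
  let ?A = "poly_row as" and ?A' = "transpose_mat (poly_row as')"
    and ?B = "poly_row bs" and ?B' = "transpose_mat (poly_row bs')"
  let ?r = "const_mat (r \<cdot>\<^sub>m 1\<^sub>m 1)" and ?q = "const_mat (q \<cdot>\<^sub>m 1\<^sub>m 1)"
  have c: "?A \<in> carrier_mat 1 i" "?A' \<in> carrier_mat j 1" "poly_row [a] \<in> carrier_mat 1 1"
    "?B \<in> carrier_mat 1 i" "?B' \<in> carrier_mat j 1" "poly_row [b] \<in> carrier_mat 1 1"
    using len by simp_all
  have rq: "?r \<in> carrier_mat 1 1" "?q \<in> carrier_mat 1 1" by simp_all
  have cR: "const_mat R11 \<in> carrier_mat i i" "const_mat R12 \<in> carrier_mat i 1"
    "const_mat Q12 \<in> carrier_mat 1 j" "const_mat Q22 \<in> carrier_mat j j" using R Q by simp_all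
  have L: "Lmat as as' a * const_mat (four_block_mat R11 R12 (0\<^sub>m 1 i) (r \<cdot>\<^sub>m 1\<^sub>m 1)) =
      four_block_mat (?A * const_mat R11) (?A * const_mat R12 + poly_row [a] * ?r)
        (0\<^sub>m j i) (?A' * ?r)"
    unfolding Lmat_four_block len
      const_mat_four_block[OF R zero_carrier_mat smult_carrier_mat[OF one_carrier_mat]]
    by (subst mult_four_block_mat[of _ 1 i _ 1 _ j _ _ i _ 1]) (use c cR rq in simp_all)
  have L': "const_mat (four_block_mat (q \<cdot>\<^sub>m 1\<^sub>m 1) Q12 (0\<^sub>m j 1) Q22) * Lmat bs bs' b =
      four_block_mat (?q * ?B) (?q * poly_row [b] + const_mat Q12 * ?B') (0\<^sub>m j i) (const_mat Q22 * ?B')"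
    unfolding Lmat_four_block len
      const_mat_four_block[OF smult_carrier_mat[OF one_carrier_mat] Q(1) zero_carrier_mat Q(2)]
      const_mat_zero mult_four_block_mat[OF rq(2) cR(3) zero_carrier_mat cR(4) c(4,6) zero_carrier_mat c(5)]
      right_mult_zero_mat[OF cR(3)] right_mult_zero_mat[OF cR(4)]
      left_mult_zero_mat[OF c(4)] left_mult_zero_mat[OF c(6)]
      right_add_zero_mat[OF mult_carrier_mat[OF rq(2) c(4)]]
      left_add_zero_mat[OF mult_carrier_mat[OF cR(4) c(5)]]
      left_add_zero_mat[OF zero_carrier_mat] ..
  have qB: "?q * ?B = [:q:] \<cdot>\<^sub>m ?B"
    unfolding const_mat_smult const_mat_one
    by (subst mult_smult_assoc_mat[OF one_carrier_mat c(4)]) (simp add: left_mult_one_mat[OF c(4)])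
  have "?A' * ?r = [:r:] \<cdot>\<^sub>m ?A'"
    unfolding const_mat_smult const_mat_one
    by (subst mult_smult_distrib[OF c(2) one_carrier_mat]) (simp add: right_mult_one_mat[OF c(2)])
  then have Ar: "transpose_mat (?A' * ?r) = [:r:] \<cdot>\<^sub>m poly_row as'"
    by (intro eq_matI) simp_all
  have QB: "transpose_mat (const_mat Q22 * ?B') = poly_row bs' * const_mat (transpose_mat Q22)"
    unfolding const_mat_transpose using transpose_mult[OF cR(4) c(5)] by simp
  have QB': "transpose_mat (const_mat Q12 * ?B') = poly_row bs' * const_mat (transpose_mat Q12)"
    unfolding const_mat_transpose using transpose_mult[OF cR(3) c(5)] by simp
  have QB'0: "(const_mat Q12 * ?B') $$ (0, 0) = (poly_row bs' * const_mat (transpose_mat Q12)) $$ (0, 0)"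
    unfolding QB'[symmetric] using cR c by (subst index_transpose_mat) auto
  have e3: "?A' * ?r = const_mat Q22 * ?B' \<longleftrightarrow>
      [:r:] \<cdot>\<^sub>m poly_row as' = poly_row bs' * const_mat (transpose_mat Q22)"
    unfolding Ar[symmetric] QB[symmetric] by (metis transpose_transpose)
  have mat11: "X = Y \<longleftrightarrow> X $$ (0, 0) = Y $$ (0, 0)" if "X \<in> carrier_mat 1 1" "Y \<in> carrier_mat 1 1"
    for X Y :: "'k poly mat"
    using that by (auto intro!: eq_matI)
  have "(poly_row [a] * ?r) $$ (0, 0) = smult r a" "(?q * poly_row [b]) $$ (0, 0) = smult q b"
    by (simp_all add: scalar_prod_def)
  then have e2: "?A * const_mat R12 + poly_row [a] * ?r = ?q * poly_row [b] + const_mat Q12 * ?B' \<longleftrightarrow>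
     (?A * const_mat R12) $$ (0, 0) + smult r a =
      smult q b + (poly_row bs' * const_mat (transpose_mat Q12)) $$ (0, 0)"
    unfolding QB'0[symmetric] using c cR rq
    by (subst mat11) (simp_all del: index_mult_mat(1))
  show ?thesis unfolding L L' e2[symmetric] e3[symmetric] qB[symmetric]
    by (subst four_block_mat_inj[of _ 1 i _ 1 _ j])
      (use c cR rq mult_carrier_mat[OF rq(2) c(4)] in simp_all)
qed

lemma index_one_by_one:
  assumes "X \<in> carrier_mat 1 1" "Y \<in> carrier_mat 1 1"
  shows "(X + Y) $$ (0, 0) = X $$ (0, 0) + Y $$ (0, 0)" "(c \<cdot>\<^sub>m X) $$ (0, 0) = c * X $$ (0, 0)"
  using assms by auto

text \<open>The assumption \<open>corner\<close> makes \<open>Q\<close> and \<open>R\<close> block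
  triangular, which is the part of the argument that differs between the families. Afterwards the
  three block equations can be solved for \<open>bs\<close>, \<open>bs'\<close> and
  \<open>b\<close>, and the solution is the action of an element of \<open>V\<close>.\<close>

lemma Lmat_orbit_iff:
  fixes as as' bs bs' :: "'k::field poly list"
  assumes len: "length as = i" "length as' = j" "length bs = i" "length bs' = j"
    and corner: "\<And>Q R :: 'k mat. Q \<in> carrier_mat (j + 1) (j + 1) \<Longrightarrow> R \<in> carrier_mat (i + 1) (i + 1) \<Longrightarrow>
      Lmat as as' a * const_mat R = const_mat Q * Lmat bs bs' b \<Longrightarrow>
      (\<forall>s<i. R $$ (i, s) = 0) \<and> (\<forall>t<j. Q $$ (Suc t, 0) = 0)"
  shows "(\<exists>Q \<in> GL (j + 1). \<exists>R \<in> GL (i + 1). Lmat as as' a * const_mat R = const_mat Q * Lmat bs bs' b) \<longleftrightarrow>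
    (\<exists>g \<in> V i j 1. poly_row (bs @ bs' @ [b]) = poly_row (as @ as' @ [a]) * const_mat g)"
    (is "?L \<longleftrightarrow> ?R")
proof
  let ?A = "poly_row as" and ?A' = "poly_row as'" and ?B = "poly_row bs" and ?B' = "poly_row bs'"
  have c: "?A \<in> carrier_mat 1 i" "?A' \<in> carrier_mat 1 j" "?B \<in> carrier_mat 1 i" "?B' \<in> carrier_mat 1 j"
    using len by simp_all
  assume ?L
  then obtain Q R where QR: "Q \<in> GL (j + 1)" "R \<in> GL (i + 1)"
    and eq: "Lmat as as' a * const_mat R = const_mat Q * Lmat bs bs' b" by blast
  have Rc: "R \<in> carrier_mat (i + 1) (i + 1)" and Qc: "Q \<in> carrier_mat (1 + j) (1 + j)"
    using QR[THEN GL_carrier] by simp_all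
  obtain R11 R12 R21 R22 where R: "R11 \<in> carrier_mat i i" "R12 \<in> carrier_mat i 1"
    "R21 \<in> carrier_mat 1 i" "R22 \<in> carrier_mat 1 1" "R = four_block_mat R11 R12 R21 R22"
    using Rc by (rule four_block_mat_split)
  obtain Q11 Q12 Q21 Q22 where Q: "Q11 \<in> carrier_mat 1 1" "Q12 \<in> carrier_mat 1 j"
    "Q21 \<in> carrier_mat j 1" "Q22 \<in> carrier_mat j j" "Q = four_block_mat Q11 Q12 Q21 Q22"
    using Qc by (rule four_block_mat_split)
  \<comment> \<open>Row i is the last row of \<open>R\<close>, and \<open>Suc t\<close> runs over
    the rows of \<open>Q\<close> below the first; these are the lower left blocks \<open>R21\<close>
    and \<open>Q21\<close>.\<close>
  have van: "\<forall>s<i. R $$ (i, s) = 0" "\<forall>t<j. Q $$ (Suc t, 0) = 0"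
    using corner[OF GL_carrier[OF QR(1)] Rc eq] by blast+
  have R21: "R21 = 0\<^sub>m 1 i"
  proof (rule eq_matI)
    fix r s assume "r < dim_row (0\<^sub>m 1 i :: 'k mat)" "s < dim_col (0\<^sub>m 1 i :: 'k mat)"
    then have rs: "r = 0" "s < i" by simp_all
    have "R $$ (i, s) = R21 $$ (0, s)" unfolding R(5) using R(1-4) rs by simp
    then show "R21 $$ (r, s) = 0\<^sub>m 1 i $$ (r, s)" using van(1) rs by simp
  qed (use R in simp_all)
  have Q21: "Q21 = 0\<^sub>m j 1"
  proof (rule eq_matI)
    fix t s assume "t < dim_row (0\<^sub>m j 1 :: 'k mat)" "s < dim_col (0\<^sub>m j 1 :: 'k mat)"
    then have ts: "s = 0" "t < j" by simp_all
    have "Q $$ (Suc t, 0) = Q21 $$ (t, 0)" unfolding Q(5) using Q(1-4) ts by simp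
    then show "Q21 $$ (t, s) = 0\<^sub>m j 1 $$ (t, s)" using van(2) ts by simp
  qed (use Q in simp_all)
  have RG: "R11 \<in> GL i" "R22 \<in> GL 1"
    using QR(2) GL_four_block_upper[OF R(1,2,4)] unfolding R(5) R21 by blast+
  have QG: "Q11 \<in> GL 1" "Q22 \<in> GL j"
    using QR(1) GL_four_block_upper[OF Q(1,2,4)] unfolding Q(5) Q21 by (simp_all add: add.commute)
  obtain r q where rq: "r \<noteq> 0" "R22 = r \<cdot>\<^sub>m 1\<^sub>m 1" "q \<noteq> 0" "Q11 = q \<cdot>\<^sub>m 1\<^sub>m 1"
    using RG(2) QG(1) unfolding GL_1_iff by blast
  obtain h where h: "h \<in> GL j" "Q22 * h = 1\<^sub>m j" "h * Q22 = 1\<^sub>m j" using GL_inverse[OF QG(2)] .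
  have hc: "transpose_mat h \<in> carrier_mat j j" "transpose_mat Q22 \<in> carrier_mat j j"
    "transpose_mat Q12 \<in> carrier_mat j 1"
    using GL_carrier[OF h(1)] Q by simp_all
  note E = eq[unfolded R(5) Q(5) R21 Q21 rq(2,4) Lmat_intertwine_iff[OF len R(1,2) Q(2,4)]]
  have e1: "?A * const_mat R11 = [:q:] \<cdot>\<^sub>m ?B" and
    e2: "(?A * const_mat R12) $$ (0, 0) + smult r a =
      smult q b + (?B' * const_mat (transpose_mat Q12)) $$ (0, 0)" and
    e3: "[:r:] \<cdot>\<^sub>m ?A' = ?B' * const_mat (transpose_mat Q22)"
    using E by blast+
  \<comment> \<open>Solving with h inverse to \<open>Q22\<close>: bs = as (R11 / q), bs' = as' (r
    h^T), b = (as R12 + r a - bs' Q12^T) / q. Replacing bs' by as' g22 in the last formula produces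
    \<open>g23\<close> and its sign.\<close>
  define g11 g22 where "g11 = inverse q \<cdot>\<^sub>m R11" and "g22 = r \<cdot>\<^sub>m transpose_mat h"
  define g13 g23 where "g13 = inverse q \<cdot>\<^sub>m R12" and "g23 = (- inverse q) \<cdot>\<^sub>m (g22 * transpose_mat Q12)"
  define g33 :: "'k mat" where "g33 = (r / q) \<cdot>\<^sub>m 1\<^sub>m 1"
  have G: "g11 \<in> GL i" "g22 \<in> GL j" "g33 \<in> GL 1"
    using GL_smult RG(1) GL_transpose[OF h(1)] rq(1,3) one_mat_GL
    unfolding g11_def g22_def g33_def by (metis GL_smult inverse_nonzero_iff_nonzero divide_eq_0_iff)+
  have gc: "g13 \<in> carrier_mat i 1" "g23 \<in> carrier_mat j 1"
    using R(2) hc GL_carrier[OF G(2)] by (simp_all add: g13_def g23_def)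
  have 1: "?B = ?A * const_mat g11"
  proof -
    have "?A * const_mat g11 = [:inverse q:] \<cdot>\<^sub>m ([:q:] \<cdot>\<^sub>m ?B)"
      unfolding g11_def mult_const_smult[OF c(1) R(1)] e1 ..
    also have "\<dots> = ?B" using rq(3) by (intro eq_matI) simp_all
    finally show ?thesis by simp
  qed
  have 2: "?B' = ?A' * const_mat g22"
  proof -
    have hc': "const_mat (transpose_mat h) \<in> carrier_mat j j" "const_mat (transpose_mat Q22) \<in> carrier_mat j j"
      using hc by simp_all
    have "transpose_mat Q22 * transpose_mat h = 1\<^sub>m j"
      using transpose_mult[OF GL_carrier[OF h(1)] Q(4)] h(3) by simp
    then have inv: "const_mat (transpose_mat Q22) * const_mat (transpose_mat h) = 1\<^sub>m j"
      unfolding const_mat_mult[OF hc(2,1), symmetric] by simp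
    have "?A' * const_mat g22 = [:r:] \<cdot>\<^sub>m (?A' * const_mat (transpose_mat h))"
      unfolding g22_def by (rule mult_const_smult[OF c(2) hc(1)])
    also have "\<dots> = ([:r:] \<cdot>\<^sub>m ?A') * const_mat (transpose_mat h)"
      by (rule mult_smult_assoc_mat[symmetric, OF c(2) hc'(1)])
    also have "\<dots> = ?B' * (const_mat (transpose_mat Q22) * const_mat (transpose_mat h))"
      unfolding e3 by (rule assoc_mult_mat[OF c(4) hc'(2,1)])
    also have "\<dots> = ?B'" unfolding inv by (rule right_mult_one_mat[OF c(4)])
    finally show ?thesis by simp
  qed
  have 3: "poly_row [b] = ?A * const_mat g13 + ?A' * const_mat g23 + poly_row [a] * const_mat g33"
    (is "_ = ?S")
  proof (rule eq_matI)
    let ?x = "(?A * const_mat R12) $$ (0, 0)" and ?y = "(?B' * const_mat (transpose_mat Q12)) $$ (0, 0)"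
    have g22c: "g22 \<in> carrier_mat j j" by (rule GL_carrier[OF G(2)])
    have "?A' * const_mat (g22 * transpose_mat Q12) = ?B' * const_mat (transpose_mat Q12)"
      unfolding 2 const_mat_mult[OF g22c hc(3)]
      by (rule assoc_mult_mat[symmetric, OF c(2)]) (use g22c hc(3) in auto)
    then have y: "?A' * const_mat g23 = [:- inverse q:] \<cdot>\<^sub>m (?B' * const_mat (transpose_mat Q12))"
      unfolding g23_def mult_const_smult[OF c(2) mult_carrier_mat[OF g22c hc(3)]] by simp
    have x: "?A * const_mat g13 = [:inverse q:] \<cdot>\<^sub>m (?A * const_mat R12)"
      unfolding g13_def by (rule mult_const_smult[OF c(1) R(2)])
    have z: "(poly_row [a] * const_mat g33) $$ (0, 0) = smult (r / q) a"
      unfolding g33_def by (simp add: scalar_prod_def)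
    have cs: "?A * const_mat R12 \<in> carrier_mat 1 1" "?B' * const_mat (transpose_mat Q12) \<in> carrier_mat 1 1"
      "poly_row [a] * const_mat g33 \<in> carrier_mat 1 1"
      using c R(2) hc(3) by (auto simp: g33_def)
    have "?S $$ (0, 0) = smult (inverse q) ?x + smult (- inverse q) ?y + smult (r / q) a"
      unfolding x y z[symmetric] index_one_by_one(1)[OF add_carrier_mat[OF smult_carrier_mat[OF cs(2)]] cs(3)]
        index_one_by_one(1)[OF smult_carrier_mat[OF cs(1)] smult_carrier_mat[OF cs(2)]]
        index_one_by_one(2)[OF cs(1,1)] index_one_by_one(2)[OF cs(2,2)]
      by simp
    also have "\<dots> = smult (inverse q) (?x + smult r a - ?y)"
      by (simp add: smult_add_right smult_diff_right divide_inverse mult.commute)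
    also have "?x + smult r a - ?y = smult q b" using e2 by (simp add: algebra_simps)
    also have "smult (inverse q) (smult q b) = b" using rq(3) by simp
    finally have S: "?S $$ (0, 0) = b" .
    fix u v assume "u < dim_row ?S" "v < dim_col ?S"
    then have "u = 0" "v = 0" using G(3)[THEN GL_carrier] by auto
    then show "poly_row [b] $$ (u, v) = ?S $$ (u, v)" using S by simp
  qed (use G(3)[THEN GL_carrier] in auto)
  let ?g = "four_block_mat (four_block_mat g11 (0\<^sub>m i j) (0\<^sub>m j i) g22) (g13 @\<^sub>r g23) (0\<^sub>m 1 (i + j)) g33"
  have "?g \<in> V i j 1" unfolding V_def using G gc by blast
  moreover have "poly_row (bs @ bs' @ [b]) = poly_row (as @ as' @ [a]) * const_mat ?g"
    unfolding poly_row_mult_V[OF len G[THEN GL_carrier] gc] using 1 2 3 by blast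
  ultimately show ?R by blast
next
  let ?A = "poly_row as" and ?A' = "poly_row as'" and ?B = "poly_row bs" and ?B' = "poly_row bs'"
  have c: "?A \<in> carrier_mat 1 i" "?A' \<in> carrier_mat 1 j" "?B \<in> carrier_mat 1 i" "?B' \<in> carrier_mat 1 j"
    using len by simp_all
  assume ?R
  then obtain g11 g22 g33 g13 g23 where G: "g11 \<in> GL i" "g22 \<in> GL j" "g33 \<in> GL 1"
    and gc: "g13 \<in> carrier_mat i 1" "g23 \<in> carrier_mat j 1"
    and eq: "poly_row (bs @ bs' @ [b]) = poly_row (as @ as' @ [a]) *
      const_mat (four_block_mat (four_block_mat g11 (0\<^sub>m i j) (0\<^sub>m j i) g22) (g13 @\<^sub>r g23)
        (0\<^sub>m 1 (i + j)) g33)"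
    unfolding V_def by blast
  have e1: "?B = ?A * const_mat g11" and e2: "?B' = ?A' * const_mat g22" and
    e3: "poly_row [b] = ?A * const_mat g13 + ?A' * const_mat g23 + poly_row [a] * const_mat g33"
    using eq unfolding poly_row_mult_V[OF len G[THEN GL_carrier] gc] by blast+
  obtain r where r: "r \<noteq> 0" "g33 = r \<cdot>\<^sub>m 1\<^sub>m 1" using G(3) unfolding GL_1_iff by blast
  obtain h where h: "h \<in> GL j" "g22 * h = 1\<^sub>m j" "h * g22 = 1\<^sub>m j" using GL_inverse[OF G(2)] .
  note hc = GL_carrier[OF h(1)] and g22c = GL_carrier[OF G(2)]
  \<comment> \<open>The solution formulas are inverted with the normalisation q = 1. Since bs' = as'
    g22, the factor h = g22^-1 turns bs' Q22^T into r as' and bs' Q12^T into - as' g23.\<close>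
  define Q12 Q22 where "Q12 = transpose_mat (- 1 \<cdot>\<^sub>m (h * g23))" and "Q22 = transpose_mat (r \<cdot>\<^sub>m h)"
  have Q: "Q12 \<in> carrier_mat 1 j" "Q22 \<in> carrier_mat j j"
    using hc gc by (simp_all add: Q12_def Q22_def)
  have Bh: "?B' * const_mat X = ?A' * const_mat (g22 * X)" if "X \<in> carrier_mat j n" for X n
    unfolding e2 const_mat_mult[OF g22c that]
    by (rule assoc_mult_mat[OF c(2)]) (use g22c that in auto)
  have "?B' * const_mat (transpose_mat Q22) = [:r:] \<cdot>\<^sub>m ?A'"
    unfolding Q22_def transpose_transpose mult_const_smult[OF c(4) hc] Bh[OF hc] h(2) const_mat_one
      right_mult_one_mat[OF c(2)] ..
  moreover have "(?A * const_mat g13) $$ (0, 0) + smult r a =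
      smult 1 b + (?B' * const_mat (transpose_mat Q12)) $$ (0, 0)"
  proof -
    have hg: "h * g23 \<in> carrier_mat j 1" using hc gc by simp
    have "g22 * (h * g23) = g23"
      using assoc_mult_mat[OF g22c hc gc(2)] h(2) gc(2) by simp
    then have y: "?B' * const_mat (transpose_mat Q12) = [:-1:] \<cdot>\<^sub>m (?A' * const_mat g23)"
      unfolding Q12_def transpose_transpose mult_const_smult[OF c(4) hg] Bh[OF hg] by simp
    have z: "(poly_row [a] * const_mat g33) $$ (0, 0) = smult r a"
      unfolding r(2) by (simp add: scalar_prod_def)
    have cs: "?A * const_mat g13 \<in> carrier_mat 1 1" "?A' * const_mat g23 \<in> carrier_mat 1 1"
      "poly_row [a] * const_mat g33 \<in> carrier_mat 1 1"
      using c gc by (auto simp: r(2))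
    have "b = poly_row [b] $$ (0, 0)" by simp
    also have "\<dots> = (?A * const_mat g13) $$ (0, 0) + (?A' * const_mat g23) $$ (0, 0) + smult r a"
      unfolding e3 z[symmetric] index_one_by_one(1)[OF add_carrier_mat[OF cs(2)] cs(3)]
        index_one_by_one(1)[OF cs(1,2)] ..
    finally show ?thesis unfolding y index_one_by_one(2)[OF cs(2,2)] by simp
  qed
  moreover have "?A * const_mat g11 = [:1:] \<cdot>\<^sub>m ?B"
    unfolding e1 by (rule eq_matI) simp_all
  ultimately have "Lmat as as' a * const_mat (four_block_mat g11 g13 (0\<^sub>m 1 i) (r \<cdot>\<^sub>m 1\<^sub>m 1)) =
      const_mat (four_block_mat (1 \<cdot>\<^sub>m 1\<^sub>m 1) Q12 (0\<^sub>m j 1) Q22) * Lmat bs bs' b"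
    unfolding Lmat_intertwine_iff[OF len GL_carrier[OF G(1)] gc(1) Q] by simp
  moreover have "four_block_mat g11 g13 (0\<^sub>m 1 i) (r \<cdot>\<^sub>m 1\<^sub>m 1) \<in> GL (i + 1)"
    using GL_four_block_upper[OF GL_carrier[OF G(1)] gc(1) GL_carrier[OF G(3)]] G(1,3) r(2) by simp
  moreover have "four_block_mat (1 \<cdot>\<^sub>m 1\<^sub>m 1) Q12 (0\<^sub>m j 1) Q22 \<in> GL (j + 1)"
  proof -
    have 1: "(1 :: 'k) \<cdot>\<^sub>m 1\<^sub>m 1 \<in> GL 1" by (intro GL_smult one_mat_GL) simp
    have 2: "Q22 \<in> GL j" unfolding Q22_def by (intro GL_transpose GL_smult h(1) r(1))
    show ?thesis
      using GL_four_block_upper[OF GL_carrier[OF 1] Q] 1 2 by (simp only: add.commute[of j 1])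
  qed
  ultimately show ?L by blast
qed

section \<open>Blocks \<alpha> with a single row or a single column\<close>

lemma frakA_lin_indep:
  assumes "Lambda m i1 i3 \<alpha> \<in> frakA m i1 i3" "\<alpha> \<in> carrier_mat i1 i3"
  shows "i1 + i3 \<le> m + 2" "lin_indep_rows \<alpha>" "lin_indep_cols \<alpha>"
proof -
  obtain \<alpha>' where \<alpha>': "Lambda m i1 i3 \<alpha> = Lambda m i1 i3 \<alpha>'" "i1 + i3 \<le> m + 2"
    "\<alpha>' \<in> carrier_mat i1 i3" "lin_indep_rows \<alpha>'" "lin_indep_cols \<alpha>'"
    using assms(1) by (auto simp: frakA_def)
  then have "\<alpha> = \<alpha>'" using Lambda_inj[OF \<alpha>'(2) assms(2) \<alpha>'(3,1)] by simp
  then show "i1 + i3 \<le> m + 2" "lin_indep_rows \<alpha>" "lin_indep_cols \<alpha>" using \<alpha>' by simp_all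
qed

lemma const_scalar_mult:
  assumes "B \<in> carrier_mat n l"
  shows "const_mat (c \<cdot>\<^sub>m 1\<^sub>m n) * B = [:c:] \<cdot>\<^sub>m B"
  unfolding const_mat_smult const_mat_one mult_smult_assoc_mat[OF one_carrier_mat assms]
    left_mult_one_mat[OF assms] ..

lemma mult_const_scalar:
  assumes "B \<in> carrier_mat l n"
  shows "B * const_mat (c \<cdot>\<^sub>m 1\<^sub>m n) = [:c:] \<cdot>\<^sub>m B"
  unfolding mult_const_smult[OF assms one_carrier_mat] const_mat_one right_mult_one_mat[OF assms] ..

lemma smult_smult_inverse_const:
  fixes A :: "'k::field poly mat"
  assumes "c \<noteq> 0"
  shows "[:inverse c:] \<cdot>\<^sub>m ([:c:] \<cdot>\<^sub>m A) = A"
  by (rule eq_matI) (use assms in simp_all)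

text \<open>With a single row \<open>Q\<close> is a nonzero scalar, and dividing \<open>R\<close> by
  it leaves only a right factor.\<close>

lemma row_orbit_iff:
  fixes \<alpha> \<beta> :: "'k::field poly mat"
  assumes \<alpha>: "\<alpha> \<in> carrier_mat 1 j" and \<beta>: "\<beta> \<in> carrier_mat 1 j"
  shows "(\<exists>Q \<in> GL 1. \<exists>R \<in> GL j. \<alpha> * const_mat R = const_mat Q * \<beta>) \<longleftrightarrow>
    (\<exists>Q \<in> GL j. \<beta> = \<alpha> * const_mat Q)"
proof
  assume "\<exists>Q \<in> GL 1. \<exists>R \<in> GL j. \<alpha> * const_mat R = const_mat Q * \<beta>"
  then obtain Q R where Q: "Q \<in> GL 1" and R: "R \<in> GL j"
    and eqQ: "\<alpha> * const_mat R = const_mat Q * \<beta>" by (elim bexE)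
  obtain q where q: "q \<noteq> 0" and Qq: "Q = q \<cdot>\<^sub>m 1\<^sub>m 1" using Q unfolding GL_1_iff by (elim exE conjE)
  note eq = eqQ[unfolded Qq]
  have "\<alpha> * const_mat (inverse q \<cdot>\<^sub>m R) = \<beta>"
    unfolding mult_const_smult[OF \<alpha> GL_carrier[OF R]] eq const_scalar_mult[OF \<beta>]
    by (rule smult_smult_inverse_const[OF q])
  moreover have "inverse q \<cdot>\<^sub>m R \<in> GL j" using GL_smult[OF R] q by simp
  ultimately show "\<exists>Q \<in> GL j. \<beta> = \<alpha> * const_mat Q" by blast
next
  assume "\<exists>Q \<in> GL j. \<beta> = \<alpha> * const_mat Q"
  then obtain R where "R \<in> GL j" "\<alpha> * const_mat R = const_mat (1\<^sub>m 1) * \<beta>"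
    unfolding const_mat_one left_mult_one_mat[OF \<beta>] by (metis)
  then show "\<exists>Q \<in> GL 1. \<exists>R \<in> GL j. \<alpha> * const_mat R = const_mat Q * \<beta>"
    by (intro bexI[OF _ one_mat_GL] bexI)
qed

text \<open>With a single column \<open>R\<close> is a nonzero scalar r, so \<beta> = (r Q^-1)
  \<alpha>. In the converse the left factor passes to the other side as its inverse h, with
  \<open>R\<close> the identity.\<close>

lemma column_orbit_iff:
  fixes \<alpha> \<beta> :: "'k::field poly mat"
  assumes \<alpha>: "\<alpha> \<in> carrier_mat i 1" and \<beta>: "\<beta> \<in> carrier_mat i 1"
  shows "(\<exists>Q \<in> GL i. \<exists>R \<in> GL 1. \<alpha> * const_mat R = const_mat Q * \<beta>) \<longleftrightarrow>
    (\<exists>Q \<in> GL i. \<beta> = const_mat Q * \<alpha>)"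
proof
  assume "\<exists>Q \<in> GL i. \<exists>R \<in> GL 1. \<alpha> * const_mat R = const_mat Q * \<beta>"
  then obtain Q R where Q: "Q \<in> GL i" and R: "R \<in> GL 1"
    and eqR: "\<alpha> * const_mat R = const_mat Q * \<beta>" by (elim bexE)
  obtain r where r: "r \<noteq> 0" and Rr: "R = r \<cdot>\<^sub>m 1\<^sub>m 1" using R unfolding GL_1_iff by (elim exE conjE)
  note eq = eqR[unfolded Rr mult_const_scalar[OF \<alpha>]]
  obtain h where h: "h \<in> GL i" "h * Q = 1\<^sub>m i" using GL_inverse[OF Q] by metis
  note hc = GL_carrier[OF h(1)] and Qc = GL_carrier[OF Q]
  have hc': "const_mat h \<in> carrier_mat i i" and Qc': "const_mat Q \<in> carrier_mat i i"
    using hc Qc by simp_all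
  have "const_mat (r \<cdot>\<^sub>m h) * \<alpha> = const_mat h * ([:r:] \<cdot>\<^sub>m \<alpha>)"
    unfolding const_mat_smult mult_smult_assoc_mat[OF hc' \<alpha>] mult_smult_distrib[OF hc' \<alpha>] ..
  also have "\<dots> = const_mat (h * Q) * \<beta>"
    unfolding eq const_mat_mult[OF hc Qc] by (rule assoc_mult_mat[OF hc' Qc' \<beta>, symmetric])
  also have "\<dots> = \<beta>" unfolding h(2) const_mat_one by (rule left_mult_one_mat[OF \<beta>])
  finally show "\<exists>Q \<in> GL i. \<beta> = const_mat Q * \<alpha>"
    using GL_smult[OF h(1) r] by blast
next
  assume "\<exists>Q \<in> GL i. \<beta> = const_mat Q * \<alpha>"
  then obtain Q where Q: "Q \<in> GL i" and eq: "\<beta> = const_mat Q * \<alpha>" by blast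
  obtain h where h: "h \<in> GL i" "h * Q = 1\<^sub>m i" using GL_inverse[OF Q] by metis
  note hc = GL_carrier[OF h(1)] and Qc = GL_carrier[OF Q]
  have hc': "const_mat h \<in> carrier_mat i i" and Qc': "const_mat Q \<in> carrier_mat i i"
    using hc Qc by simp_all
  have "const_mat h * \<beta> = const_mat (h * Q) * \<alpha>"
    unfolding eq const_mat_mult[OF hc Qc] by (rule assoc_mult_mat[OF hc' Qc' \<alpha>, symmetric])
  also have "\<dots> = \<alpha> * const_mat (1\<^sub>m 1)"
    unfolding h(2) const_mat_one left_mult_one_mat[OF \<alpha>] right_mult_one_mat[OF \<alpha>] ..
  finally show "\<exists>Q \<in> GL i. \<exists>R \<in> GL 1. \<alpha> * const_mat R = const_mat Q * \<beta>"
    by (intro bexI[OF _ h(1)] bexI[OF _ one_mat_GL]) simp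
qed

section \<open>Vanishing of the lower left blocks of an intertwining pair\<close>

text \<open>These are the entries of the equation in row \<open>Suc t\<close>: before the last
  column each side has a single term, and in the last column the right-hand side collects
  \<open>b\<close> and all of \<open>bs'\<close>.\<close>

lemma Lmat_intertwine_corner:
  assumes "length as = i" "length as' = j" "length bs = i" "length bs' = j"
    and "Q \<in> carrier_mat (j + 1) (j + 1)" "R \<in> carrier_mat (i + 1) (i + 1)"
    and eq: "Lmat as as' a * const_mat R = const_mat Q * Lmat bs bs' b" and t: "t < j"
  shows "s < i \<Longrightarrow> smult (R $$ (i, s)) (as' ! t) = smult (Q $$ (Suc t, 0)) (bs ! s)"
    "smult (R $$ (i, i)) (as' ! t) =
      smult (Q $$ (Suc t, 0)) b + (\<Sum>u<j. smult (Q $$ (Suc t, Suc u)) (bs' ! u))"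
proof -
  have R: "R \<in> carrier_mat (length as + 1) (i + 1)" and Q: "Q \<in> carrier_mat (j + 1) (length bs' + 1)"
    using assms by simp_all
  have l: "(Lmat as as' a * const_mat R) $$ (Suc t, s) = smult (R $$ (i, s)) (as' ! t)" if "s < i + 1" for s
    using Lmat_mult_const_index(2)[OF R that, of t as' a] t assms(1,2) by simp
  show "smult (R $$ (i, s)) (as' ! t) = smult (Q $$ (Suc t, 0)) (bs ! s)" if s: "s < i"
    using l[of s] const_mult_Lmat_index(1)[OF Q, of "Suc t" s bs b] t s assms(3) unfolding eq by simp
  show "smult (R $$ (i, i)) (as' ! t) =
      smult (Q $$ (Suc t, 0)) b + (\<Sum>u<j. smult (Q $$ (Suc t, Suc u)) (bs' ! u))"
    using l[of i] const_mult_Lmat_index(2)[OF Q, of "Suc t" bs b] t assms(3,4) unfolding eq by simp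
qed

text \<open>If \<open>R $$ (i, s)\<close> were nonzero, then \<open>as' ! 0\<close> would be
  proportional to \<open>bs ! s\<close>. For j \<ge> 2 this makes two members of \<open>as'\<close>
  proportional, otherwise i \<ge> 2 and two members of \<open>bs\<close> are. Once the last row of
  \<open>R\<close> vanishes there, \<open>bs ! 0\<close> being nonzero kills the entries of
  \<open>Q\<close>.\<close>

lemma Lmat_corner_vanishes:
  fixes Q R :: "'k::field mat"
  assumes len: "length as = i" "length as' = j" "length bs = i" "length bs' = j"
    and ij: "1 \<le> i" "1 \<le> j" "3 \<le> i + j" and ind: "lin_indep as'" "lin_indep bs"
    and QR: "Q \<in> carrier_mat (j + 1) (j + 1)" "R \<in> carrier_mat (i + 1) (i + 1)"
    and eq: "Lmat as as' a * const_mat R = const_mat Q * Lmat bs bs' b"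
  shows "(\<forall>s<i. R $$ (i, s) = 0) \<and> (\<forall>t<j. Q $$ (Suc t, 0) = 0)"
proof -
  note e = Lmat_intertwine_corner(1)[OF len QR eq]
  have nz: "as' ! 0 \<noteq> 0" "bs ! 0 \<noteq> 0"
    using lin_indep_nth_nonzero[OF ind(1), of 0] lin_indep_nth_nonzero[OF ind(2), of 0] ij len
    by simp_all
  have R: "R $$ (i, s) = 0" if s: "s < i" for s
  proof (rule ccontr)
    assume nR: "R $$ (i, s) \<noteq> 0"
    have nQ: "Q $$ (Suc 0, 0) \<noteq> 0"
      using e[of 0 s] s nR nz(1) ij by auto
    show False
    proof (cases "2 \<le> j")
      case True
      have e0: "smult (R $$ (i, s)) (as' ! 0) = smult (Q $$ (Suc 0, 0)) (bs ! s)"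
        and e1: "smult (R $$ (i, s)) (as' ! 1) = smult (Q $$ (Suc 1, 0)) (bs ! s)"
        using e[of 0 s] e[of 1 s] s True by simp_all
      \<comment> \<open>The common multiple \<open>bs ! s\<close> is eliminated by cross
        multiplication; the coefficient of \<open>as' ! 1\<close> is a product of nonzero
        scalars.\<close>
      have "smult (Q $$ (Suc 0, 0) * R $$ (i, s)) (as' ! 1) =
          smult (Q $$ (Suc 0, 0)) (smult (R $$ (i, s)) (as' ! 1))" by simp
      also have "\<dots> = smult (Q $$ (Suc 1, 0)) (smult (R $$ (i, s)) (as' ! 0))"
        unfolding e0 e1 by (simp add: mult.commute)
      also have "\<dots> = smult (Q $$ (Suc 1, 0) * R $$ (i, s)) (as' ! 0)" by simp
      finally have "smult (Q $$ (Suc 0, 0) * R $$ (i, s)) (as' ! 1) =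
        smult (Q $$ (Suc 1, 0) * R $$ (i, s)) (as' ! 0)" .
      from lin_indep_two[OF ind(1) _ _ _ this] show False using True nR nQ len by simp
    next
      case False
      then have i: "2 \<le> i" using ij by simp
      \<comment> \<open>Any index below i other than s would do; 0 or 1 is available because i \<ge>
        2.\<close>
      define s' :: nat where "s' = (if s = 0 then 1 else 0)"
      have s': "s' < i" "s' \<noteq> s" using i by (auto simp: s'_def)
      have e0: "smult (R $$ (i, s)) (as' ! 0) = smult (Q $$ (Suc 0, 0)) (bs ! s)"
        and e1: "smult (R $$ (i, s')) (as' ! 0) = smult (Q $$ (Suc 0, 0)) (bs ! s')"
        using e[of 0 s] e[of 0 s'] s s' ij by simp_all
      have "smult (R $$ (i, s) * Q $$ (Suc 0, 0)) (bs ! s') =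
          smult (R $$ (i, s)) (smult (Q $$ (Suc 0, 0)) (bs ! s'))" by simp
      also have "\<dots> = smult (R $$ (i, s')) (smult (Q $$ (Suc 0, 0)) (bs ! s))"
        unfolding e0[symmetric] e1[symmetric] by (simp add: mult.commute)
      also have "\<dots> = smult (R $$ (i, s') * Q $$ (Suc 0, 0)) (bs ! s)" by simp
      finally have "smult (R $$ (i, s) * Q $$ (Suc 0, 0)) (bs ! s') =
        smult (R $$ (i, s') * Q $$ (Suc 0, 0)) (bs ! s)" .
      from lin_indep_two[OF ind(2) _ _ _ this] show False using s s' nR nQ len by simp
    qed
  qed
  moreover have "Q $$ (Suc t, 0) = 0" if "t < j" for t
    using e[of t 0] R[of 0] nz(2) that ij by simp
  ultimately show ?thesis by blast
qed

text \<open>With one element in each family, two members of the same family are not at hand, so the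
  last column has to help. Eliminating \<open>a2\<close> between the two equations of the second row
  gives a relation among b1, b2, b; its coefficient at b is minus the product of the two unwanted
  entries.\<close>

lemma Lmat_1_1_corner_vanishes:
  fixes Q R :: "'k::field mat"
  assumes ind: "lin_indep [b1, b2, b]" and a2: "a2 \<noteq> 0"
    and QR: "Q \<in> carrier_mat (1 + 1) (1 + 1)" "R \<in> carrier_mat (1 + 1) (1 + 1)"
    and eq: "Lmat [a1] [a2] a * const_mat R = const_mat Q * Lmat [b1] [b2] b"
  shows "(\<forall>s<1. R $$ (1, s) = 0) \<and> (\<forall>t<1. Q $$ (Suc t, 0) = 0)"
proof -
  have e1: "smult (R $$ (1, 0)) a2 = smult (Q $$ (1, 0)) b1"
    using Lmat_intertwine_corner(1)[OF _ _ _ _ QR eq, of 0 0] by simp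
  have e2: "smult (R $$ (1, 1)) a2 = smult (Q $$ (1, 0)) b + smult (Q $$ (1, 1)) b2"
    using Lmat_intertwine_corner(2)[OF _ _ _ _ QR eq, of 0] by simp
  \<comment> \<open>The coefficients of that relation, listed in the order b1, b2, b.\<close>
  define c where "c = (\<lambda>t :: nat. [R $$ (1, 1) * Q $$ (1, 0), - (R $$ (1, 0) * Q $$ (1, 1)),
    - (R $$ (1, 0) * Q $$ (1, 0))] ! t)"
  have "smult (R $$ (1, 1)) (smult (Q $$ (1, 0)) b1) = smult (R $$ (1, 0)) (smult (R $$ (1, 1)) a2)"
    unfolding e1[symmetric] by (simp add: mult.commute)
  then have "smult (R $$ (1, 1) * Q $$ (1, 0)) b1 =
      smult (R $$ (1, 0) * Q $$ (1, 0)) b + smult (R $$ (1, 0) * Q $$ (1, 1)) b2"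
    unfolding e2 by (simp add: smult_add_right)
  then have "(\<Sum>t<length [b1, b2, b]. smult (c t) ([b1, b2, b] ! t)) = 0"
    by (simp add: c_def numeral_eq_Suc)
  from lin_indep_sum_zero[OF ind this, of 2] have "R $$ (1, 0) * Q $$ (1, 0) = 0"
    by (simp add: c_def)
  moreover have "b1 \<noteq> 0" using lin_indep_nth_nonzero[OF ind, of 0] by simp
  ultimately have "R $$ (1, 0) = 0" "Q $$ (1, 0) = 0" using e1 a2 by auto
  then show ?thesis by simp
qed

text \<open>Since \<open>as\<close> runs along a row of \<open>L\<close> and \<open>as'\<close> down
  a column, the left factor \<open>Q\<close> has size j + 1 and the right factor \<open>R\<close>
  has size i + 1.\<close>

lemma Lambda_Lmat_equivalent_iff:
  assumes len: "length as = i" "length as' = j" "length bs = i'" "length bs' = j'"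
    and ij: "1 \<le> i" "1 \<le> j" "i + j \<le> m" "1 \<le> i'" "1 \<le> j'" "i' + j' \<le> m"
    and ind: "lin_indep as" "lin_indep as'" "lin_indep bs" "lin_indep bs'"
  shows "equivalent (m + 2) (Lambda m (j + 1) (i + 1) (Lmat as as' a))
      (Lambda m (j' + 1) (i' + 1) (Lmat bs bs' b)) \<longleftrightarrow>
    (i, j) = (i', j') \<and>
    (\<exists>Q \<in> GL (j + 1). \<exists>R \<in> GL (i + 1). Lmat as as' a * const_mat R = const_mat Q * Lmat bs bs' b)"
proof -
  have ne: "as \<noteq> []" "as' \<noteq> []" "bs \<noteq> []" "bs' \<noteq> []" using len ij by auto
  have le: "j + 1 + (i + 1) \<le> m + 2" "j' + 1 + (i' + 1) \<le> m + 2" using ij by simp_all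
  have c: "Lmat as as' a \<in> carrier_mat (j + 1) (i + 1)" "Lmat bs bs' b \<in> carrier_mat (j' + 1) (i' + 1)"
    using len by simp_all
  show ?thesis
    using Lambda_equivalent_iff[OF c(1) Lmat_lin_indep_rows[OF ind(1,2) ne(1)]
        Lmat_lin_indep_cols[OF ind(1,2) ne(2)] le(1) c(2) Lmat_lin_indep_rows[OF ind(3,4) ne(3)]
        Lmat_lin_indep_cols[OF ind(3,4) ne(4)] le(2)]
    by auto
qed

section \<open>Two-by-two blocks with zero corner\<close>

lemma mat_2_2_eq_iff:
  assumes "X \<in> carrier_mat 2 2" "Y \<in> carrier_mat 2 2"
  shows "X = Y \<longleftrightarrow> X $$ (0, 0) = Y $$ (0, 0) \<and> X $$ (0, 1) = Y $$ (0, 1) \<and>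
    X $$ (1, 0) = Y $$ (1, 0) \<and> X $$ (1, 1) = Y $$ (1, 1)"
proof
  assume e: "X $$ (0, 0) = Y $$ (0, 0) \<and> X $$ (0, 1) = Y $$ (0, 1) \<and>
    X $$ (1, 0) = Y $$ (1, 0) \<and> X $$ (1, 1) = Y $$ (1, 1)"
  show "X = Y"
  proof (rule eq_matI)
    fix r s assume "r < dim_row Y" "s < dim_col Y"
    then have "r = 0 \<or> r = 1" "s = 0 \<or> s = 1" using assms by auto
    then show "X $$ (r, s) = Y $$ (r, s)" using e by (elim disjE) simp_all
  qed (use assms in auto)
qed simp

text \<open>The determinant formula for four blocks requires the two lower blocks to commute, which
  one-by-one blocks always do.\<close>

lemma GL_2_iff:
  fixes g :: "'k::field mat"
  assumes g: "g \<in> carrier_mat 2 2"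
  shows "g \<in> GL 2 \<longleftrightarrow> g $$ (0, 0) * g $$ (1, 1) \<noteq> g $$ (0, 1) * g $$ (1, 0)"
proof -
  have "g \<in> carrier_mat (1 + 1) (1 + 1)" using g by (simp add: numeral_2_eq_2)
  then obtain A B C D where c: "A \<in> carrier_mat 1 1" "B \<in> carrier_mat 1 1" "C \<in> carrier_mat 1 1"
    "D \<in> carrier_mat 1 1" and eq: "g = four_block_mat A B C D"
    by (rule four_block_mat_split)
  have "C * D = D * C" using c by (intro eq_matI) (auto simp: scalar_prod_def)
  from det_four_block_mat[OF c this] have "det g = det (A * D - B * C)" by (simp add: eq)
  also have "\<dots> = (A * D - B * C) $$ (0, 0)" 
    by (intro det_single minus_carrier_mat mult_carrier_mat[OF c(2,3)])
  also have "\<dots> = g $$ (0, 0) * g $$ (1, 1) - g $$ (0, 1) * g $$ (1, 0)"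
    using c by (simp add: eq scalar_prod_def)
  finally show ?thesis using g by (simp add: GL_iff_det)
qed

text \<open>With zero corners the matrix equation decouples: every entry relates one of a1, a2 to
  one of b1, b2 by scalars.\<close>

lemma Lmat_1_1_intertwine_iff:
  fixes Q R :: "'k::field mat"
  assumes "Q \<in> carrier_mat 2 2" "R \<in> carrier_mat 2 2"
  shows "Lmat [a1] [a2] 0 * const_mat R = const_mat Q * Lmat [b1] [b2] 0 \<longleftrightarrow>
    smult (R $$ (0, 0)) a1 = smult (Q $$ (0, 0)) b1 \<and> smult (R $$ (0, 1)) a1 = smult (Q $$ (0, 1)) b2 \<and>
    smult (R $$ (1, 0)) a2 = smult (Q $$ (1, 0)) b1 \<and> smult (R $$ (1, 1)) a2 = smult (Q $$ (1, 1)) b2"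
proof -
  have c: "Lmat [a1] [a2] 0 * const_mat R \<in> carrier_mat 2 2"
    "const_mat Q * Lmat [b1] [b2] 0 \<in> carrier_mat 2 2"
    using assms by (intro carrier_matI; simp)+
  have R: "R \<in> carrier_mat (length [a1] + 1) 2" and Q: "Q \<in> carrier_mat 2 (length [b2] + 1)"
    using assms by (simp_all add: numeral_2_eq_2)
  show ?thesis unfolding mat_2_2_eq_iff[OF c]
    using Lmat_mult_const_index(1)[OF R, of 0 "[a2]" 0] Lmat_mult_const_index(1)[OF R, of 1 "[a2]" 0]
      Lmat_mult_const_index(2)[OF R, of 0 0 "[a2]" 0] Lmat_mult_const_index(2)[OF R, of 1 0 "[a2]" 0]
      const_mult_Lmat_index(1)[OF Q, of 0 0 "[b1]" 0] const_mult_Lmat_index(1)[OF Q, of 1 0 "[b1]" 0]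
      const_mult_Lmat_index(2)[OF Q, of 0 "[b1]" 0] const_mult_Lmat_index(2)[OF Q, of 1 "[b1]" 0]
    by simp
qed

lemma poly_row_2_mult_iff:
  assumes "g \<in> carrier_mat 2 2"
  shows "poly_row [b1, b2] = poly_row [a1, a2] * const_mat g \<longleftrightarrow>
    b1 = smult (g $$ (0, 0)) a1 + smult (g $$ (1, 0)) a2 \<and>
    b2 = smult (g $$ (0, 1)) a1 + smult (g $$ (1, 1)) a2"
proof -
  let ?X = "poly_row [a1, a2] * const_mat g"
  have X: "?X $$ (0, s) = smult (g $$ (0, s)) a1 + smult (g $$ (1, s)) a2" if "s < 2" for s
    using assms that by (simp add: scalar_prod_def numeral_2_eq_2)
  have B: "poly_row [b1, b2] $$ (0, 0) = b1" "poly_row [b1, b2] $$ (0, 1) = b2" by simp_all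
  have "poly_row [b1, b2] = ?X \<longleftrightarrow> (\<forall>s<2. poly_row [b1, b2] $$ (0, s) = ?X $$ (0, s))"
  proof
    assume e: "\<forall>s<2. poly_row [b1, b2] $$ (0, s) = ?X $$ (0, s)"
    show "poly_row [b1, b2] = ?X"
    proof (rule eq_matI)
      fix r s assume "r < dim_row ?X" "s < dim_col ?X"
      then have "r = 0" "s < 2" using assms by auto
      then show "poly_row [b1, b2] $$ (r, s) = ?X $$ (r, s)" using e by blast
    qed (use assms in auto)
  qed (simp only: simp_thms)
  also have "\<dots> \<longleftrightarrow> b1 = ?X $$ (0, 0) \<and> b2 = ?X $$ (0, 1)"
    unfolding less_2_cases_iff using B by auto
  finally show ?thesis by (simp only: X)
qed

text \<open>Since the determinant of \<open>R\<close> is nonzero, its diagonal or its anti-diagonal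
  has no zero entry. The first case gives b1 and b2 as multiples of a1 and a2, the second as
  multiples of a2 and a1.\<close>

lemma Lmat_1_1_zero_orbit_iff:
  fixes a1 a2 b1 b2 :: "'k::field poly"
  assumes nz: "a1 \<noteq> 0" "a2 \<noteq> 0" "b1 \<noteq> 0" "b2 \<noteq> 0"
  shows "(\<exists>Q \<in> GL 2. \<exists>R \<in> GL 2. Lmat [a1] [a2] 0 * const_mat R = const_mat Q * Lmat [b1] [b2] 0) \<longleftrightarrow>
    (\<exists>g \<in> GLDD2. poly_row [b1, b2] = poly_row [a1, a2] * const_mat g)"
    (is "?L \<longleftrightarrow> ?R")
proof
  define M where "M x y z w = mat 2 2 (\<lambda>(r, s). if r = 0 then if s = 0 then x else y else if s = 0 then z else w)"
    for x y z w :: 'k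
  have M: "M x y z w \<in> carrier_mat 2 2" "M x y z w $$ (0, 0) = x" "M x y z w $$ (0, 1) = y"
    "M x y z w $$ (1, 0) = z" "M x y z w $$ (1, 1) = w" for x y z w
    by (simp_all add: M_def)
  have GLM: "M x y z w \<in> GL 2 \<longleftrightarrow> x * w \<noteq> y * z" for x y z w
    unfolding GL_2_iff[OF M(1)] M ..
  have diag: "diagonal_mat (M x 0 0 w)" for x w
    by (auto simp: diagonal_mat_def M_def)
  have dd: "M x 0 0 w \<in> GLDD2" if "x \<noteq> 0" "w \<noteq> 0" for x w
    unfolding GLDD2_def mem_Collect_eq GLM using that diag by simp
  have aa: "M 0 y z 0 \<in> GLDD2" if "y \<noteq> 0" "z \<noteq> 0" for y z
    unfolding GLDD2_def mem_Collect_eq GLM M using that by simp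
  \<comment> \<open>The scalar q is nonzero automatically, because the left-hand side is; so
    division by an entry of \<open>Q\<close> is legitimate.\<close>
  have scale: "r / q \<noteq> 0 \<and> y = smult (r / q) x"
    if "smult r x = smult q y" "r \<noteq> 0" "x \<noteq> 0" for r q :: 'k and x y
  proof -
    have q: "q \<noteq> 0" using that by auto
    have "smult (r / q) x = smult (inverse q) (smult r x)" by (simp add: divide_inverse mult.commute)
    also have "\<dots> = y" unfolding that(1) using q by simp
    finally show ?thesis using q that by simp
  qed
  {
    assume ?L
    then obtain Q R where Q: "Q \<in> carrier_mat 2 2" and R: "R \<in> GL 2"
      and eq: "Lmat [a1] [a2] 0 * const_mat R = const_mat Q * Lmat [b1] [b2] 0"
      using GL_carrier by blast
    note e = eq[unfolded Lmat_1_1_intertwine_iff[OF Q GL_carrier[OF R]]]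
    have "R $$ (0, 0) * R $$ (1, 1) \<noteq> 0 \<or> R $$ (0, 1) * R $$ (1, 0) \<noteq> 0"
      using R GL_2_iff[OF GL_carrier[OF R]] by auto
    then show ?R
    proof
      assume n: "R $$ (0, 0) * R $$ (1, 1) \<noteq> 0"
      then have n: "R $$ (0, 0) \<noteq> 0" "R $$ (1, 1) \<noteq> 0" by auto
      let ?x = "R $$ (0, 0) / Q $$ (0, 0)" and ?w = "R $$ (1, 1) / Q $$ (1, 1)"
      have s: "?x \<noteq> 0 \<and> b1 = smult ?x a1" "?w \<noteq> 0 \<and> b2 = smult ?w a2"
        using scale[of "R $$ (0, 0)" a1] scale[of "R $$ (1, 1)" a2] e n nz by blast+
      then have "poly_row [b1, b2] = poly_row [a1, a2] * const_mat (M ?x 0 0 ?w)"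
        unfolding poly_row_2_mult_iff[OF M(1)] M by simp
      then show ?R using dd s by blast
    next
      assume n: "R $$ (0, 1) * R $$ (1, 0) \<noteq> 0"
      then have n: "R $$ (0, 1) \<noteq> 0" "R $$ (1, 0) \<noteq> 0" by auto
      let ?y = "R $$ (0, 1) / Q $$ (0, 1)" and ?z = "R $$ (1, 0) / Q $$ (1, 0)"
      have s: "?y \<noteq> 0 \<and> b2 = smult ?y a1" "?z \<noteq> 0 \<and> b1 = smult ?z a2"
        using scale[of "R $$ (0, 1)" a1] scale[of "R $$ (1, 0)" a2] e n nz by blast+
      then have "poly_row [b1, b2] = poly_row [a1, a2] * const_mat (M 0 ?y ?z 0)"
        unfolding poly_row_2_mult_iff[OF M(1)] M by simp
      then show ?R using aa s by blast
    qed
  }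
  assume ?R
  then obtain g where g: "g \<in> GL 2" "diagonal_mat g \<or> g $$ (0, 0) = 0 \<and> g $$ (1, 1) = 0"
    and eq: "poly_row [b1, b2] = poly_row [a1, a2] * const_mat g"
    by (auto simp: GLDD2_def)
  note gc = GL_carrier[OF g(1)]
  note e = eq[unfolded poly_row_2_mult_iff[OF gc]]
  from g(2) show ?L
  proof
    assume "diagonal_mat g"
    then have z: "g $$ (0, 1) = 0" "g $$ (1, 0) = 0" using gc by (auto simp: diagonal_mat_def)
    have "Lmat [a1] [a2] 0 * const_mat g = const_mat (1\<^sub>m 2) * Lmat [b1] [b2] 0"
      unfolding Lmat_1_1_intertwine_iff[OF one_carrier_mat gc] using e z by simp
    then show ?L using g(1) one_mat_GL by blast
  next
    assume z: "g $$ (0, 0) = 0 \<and> g $$ (1, 1) = 0"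
    \<comment> \<open>An anti-diagonal g exchanges the roles of the two families, which the
      permutation matrix on the left compensates.\<close>
    have "Lmat [a1] [a2] 0 * const_mat g = const_mat (M 0 1 1 0) * Lmat [b1] [b2] 0"
      unfolding Lmat_1_1_intertwine_iff[OF M(1) gc] M using e z by simp
    moreover have "M 0 1 1 0 \<in> GL 2" unfolding GL_2_iff[OF M(1)] M by simp
    ultimately show ?L using g(1) by blast
  qed
qed

section \<open>Equivalence criteria for the five families of exponential matrices\<close>

theorem theorem3p24:
  fixes p m :: nat
  assumes char: "CHAR('k::field) = p" and p_pos: "p > 0" and m: "m \<ge> 1"
  shows
  "(\<forall>j j' (\<alpha> :: 'k poly mat) \<beta>.
      1 \<le> j \<and> j \<le> m + 1 \<and> 1 \<le> j' \<and> j' \<le> m + 1 \<and>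
      \<alpha> \<in> carrier_mat 1 j \<and> Lambda m 1 j \<alpha> \<in> frakA m 1 j \<and>
      \<beta> \<in> carrier_mat 1 j' \<and> Lambda m 1 j' \<beta> \<in> frakA m 1 j' \<and>
      Lambda m 1 j \<alpha> \<in> (daleth_II m)\<^sup>E \<and> Lambda m 1 j' \<beta> \<in> (daleth_II m)\<^sup>E \<longrightarrow>
      (equivalent (m + 2) (Lambda m 1 j \<alpha>) (Lambda m 1 j' \<beta>) \<longleftrightarrow>
         j = j' \<and> (\<exists>Q \<in> GL j. \<beta> = \<alpha> * const_mat Q)))
   \<and>
   (\<forall>i i' (\<alpha> :: 'k poly mat) \<beta>.
      2 \<le> i \<and> i \<le> m + 1 \<and> 2 \<le> i' \<and> i' \<le> m + 1 \<and>
      \<alpha> \<in> carrier_mat i 1 \<and> Lambda m i 1 \<alpha> \<in> frakA m i 1 \<and>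
      \<beta> \<in> carrier_mat i' 1 \<and> Lambda m i' 1 \<beta> \<in> frakA m i' 1 \<and>
      Lambda m i 1 \<alpha> \<in> (daleth_III m)\<^sup>E \<and> Lambda m i' 1 \<beta> \<in> (daleth_III m)\<^sup>E \<longrightarrow>
      (equivalent (m + 2) (Lambda m i 1 \<alpha>) (Lambda m i' 1 \<beta>) \<longleftrightarrow>
         i = i' \<and> (\<exists>Q \<in> GL i. \<beta> = const_mat Q * \<alpha>)))
   \<and>
   (\<forall>(a1 :: 'k poly) a2 b1 b2.
      Lmat [a1] [a2] 0 \<in> frakL11_0 \<and> Lmat [b1] [b2] 0 \<in> frakL11_0 \<and>
      {a1, a2, b1, b2} \<subseteq> p_polys p \<and>
      Lambda m 2 2 (Lmat [a1] [a2] 0) \<in> (daleth_IV m)\<^sup>E \<and>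
      Lambda m 2 2 (Lmat [b1] [b2] 0) \<in> (daleth_IV m)\<^sup>E \<longrightarrow>
      (equivalent (m + 2) (Lambda m 2 2 (Lmat [a1] [a2] 0)) (Lambda m 2 2 (Lmat [b1] [b2] 0)) \<longleftrightarrow>
         (\<exists>g \<in> GLDD2. poly_row [b1, b2] = poly_row [a1, a2] * const_mat g)))
   \<and>
   (\<forall>(a1 :: 'k poly) a2 a b1 b2 b.
      Lmat [a1] [a2] a \<in> frakL11_dim3 \<and> Lmat [b1] [b2] b \<in> frakL11_dim3 \<and>
      {a1, a2, a, b1, b2, b} \<subseteq> p_polys p \<and>
      Lambda m 2 2 (Lmat [a1] [a2] a) \<in> (daleth_V m)\<^sup>E \<and>
      Lambda m 2 2 (Lmat [b1] [b2] b) \<in> (daleth_V m)\<^sup>E \<longrightarrow>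
      (equivalent (m + 2) (Lambda m 2 2 (Lmat [a1] [a2] a)) (Lambda m 2 2 (Lmat [b1] [b2] b)) \<longleftrightarrow>
         (\<exists>g \<in> V 1 1 1. poly_row [b1, b2, b] = poly_row [a1, a2, a] * const_mat g)))
   \<and>
   (\<forall>i j i' j' (as :: 'k poly list) as' a bs bs' b.
      1 \<le> i \<and> 1 \<le> j \<and> 1 \<le> i' \<and> 1 \<le> j' \<and>
      3 \<le> i + j \<and> i + j \<le> m \<and> 3 \<le> i' + j' \<and> i' + j' \<le> m \<and>
      length as = i \<and> length as' = j \<and> Lmat as as' a \<in> frakL i j \<and>
      length bs = i' \<and> length bs' = j' \<and> Lmat bs bs' b \<in> frakL i' j' \<and>
      set (as @ as' @ [a]) \<subseteq> p_polys p \<and> set (bs @ bs' @ [b]) \<subseteq> p_polys p \<and>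
      Lambda m (j + 1) (i + 1) (Lmat as as' a) \<in> (daleth_VI m)\<^sup>E \<and>
      Lambda m (j' + 1) (i' + 1) (Lmat bs bs' b) \<in> (daleth_VI m)\<^sup>E \<longrightarrow>
      (equivalent (m + 2)
           (Lambda m (j + 1) (i + 1) (Lmat as as' a))
           (Lambda m (j' + 1) (i' + 1) (Lmat bs bs' b)) \<longleftrightarrow>
         (i, j) = (i', j') \<and>
         (\<exists>g \<in> V i j 1. poly_row (bs @ bs' @ [b]) = poly_row (as @ as' @ [a]) * const_mat g)))"
proof (intro conjI allI impI)
  fix j j' and \<alpha> \<beta> :: "'k poly mat"
  assume H: "1 \<le> j \<and> j \<le> m + 1 \<and> 1 \<le> j' \<and> j' \<le> m + 1 \<and>
      \<alpha> \<in> carrier_mat 1 j \<and> Lambda m 1 j \<alpha> \<in> frakA m 1 j \<and>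
      \<beta> \<in> carrier_mat 1 j' \<and> Lambda m 1 j' \<beta> \<in> frakA m 1 j' \<and>
      Lambda m 1 j \<alpha> \<in> (daleth_II m)\<^sup>E \<and> Lambda m 1 j' \<beta> \<in> (daleth_II m)\<^sup>E"
  then have \<alpha>: "\<alpha> \<in> carrier_mat 1 j" "Lambda m 1 j \<alpha> \<in> frakA m 1 j"
    and \<beta>: "\<beta> \<in> carrier_mat 1 j'" "Lambda m 1 j' \<beta> \<in> frakA m 1 j'" by blast+
  note fa = frakA_lin_indep[OF \<alpha>(2,1)] and fb = frakA_lin_indep[OF \<beta>(2,1)]
  show "equivalent (m + 2) (Lambda m 1 j \<alpha>) (Lambda m 1 j' \<beta>) \<longleftrightarrow>
         j = j' \<and> (\<exists>Q \<in> GL j. \<beta> = \<alpha> * const_mat Q)"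
    unfolding Lambda_equivalent_iff[OF \<alpha>(1) fa(2,3,1) \<beta>(1) fb(2,3,1)]
    using row_orbit_iff[OF \<alpha>(1)] \<beta>(1) by blast
next
  fix i i' and \<alpha> \<beta> :: "'k poly mat"
  assume H: "2 \<le> i \<and> i \<le> m + 1 \<and> 2 \<le> i' \<and> i' \<le> m + 1 \<and>
      \<alpha> \<in> carrier_mat i 1 \<and> Lambda m i 1 \<alpha> \<in> frakA m i 1 \<and>
      \<beta> \<in> carrier_mat i' 1 \<and> Lambda m i' 1 \<beta> \<in> frakA m i' 1 \<and>
      Lambda m i 1 \<alpha> \<in> (daleth_III m)\<^sup>E \<and> Lambda m i' 1 \<beta> \<in> (daleth_III m)\<^sup>E"
  then have \<alpha>: "\<alpha> \<in> carrier_mat i 1" "Lambda m i 1 \<alpha> \<in> frakA m i 1"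
    and \<beta>: "\<beta> \<in> carrier_mat i' 1" "Lambda m i' 1 \<beta> \<in> frakA m i' 1" by blast+
  note fa = frakA_lin_indep[OF \<alpha>(2,1)] and fb = frakA_lin_indep[OF \<beta>(2,1)]
  show "equivalent (m + 2) (Lambda m i 1 \<alpha>) (Lambda m i' 1 \<beta>) \<longleftrightarrow>
         i = i' \<and> (\<exists>Q \<in> GL i. \<beta> = const_mat Q * \<alpha>)"
    unfolding Lambda_equivalent_iff[OF \<alpha>(1) fa(2,3,1) \<beta>(1) fb(2,3,1)]
    using column_orbit_iff[OF \<alpha>(1)] \<beta>(1) by blast
next
  fix a1 a2 b1 b2 :: "'k poly"
  assume H: "Lmat [a1] [a2] 0 \<in> frakL11_0 \<and> Lmat [b1] [b2] 0 \<in> frakL11_0 \<and>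
      {a1, a2, b1, b2} \<subseteq> p_polys p \<and>
      Lambda m 2 2 (Lmat [a1] [a2] 0) \<in> (daleth_IV m)\<^sup>E \<and>
      Lambda m 2 2 (Lmat [b1] [b2] 0) \<in> (daleth_IV m)\<^sup>E"
  \<comment> \<open>The bound is part of the membership in \<open>daleth_IV\<close>; written as
    \<open>1 + 1\<close> it is the size condition for i = j = 1.\<close>
  have m2: "1 + 1 \<le> m" using H by (auto simp: Exp_part_def daleth_IV_def)
  have L: "Lmat [a1] [a2] 0 \<in> frakL 1 1" "Lmat [b1] [b2] 0 \<in> frakL 1 1"
    using H by (auto simp: frakL11_0_def)
  note ind = Lmat_frakL[OF L(1)] Lmat_frakL[OF L(2)]
  have nz: "a1 \<noteq> 0" "a2 \<noteq> 0" "b1 \<noteq> 0" "b2 \<noteq> 0"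
    using ind[THEN lin_indep_nth_nonzero, of 0] by simp_all
  have "equivalent (m + 2) (Lambda m (1 + 1) (1 + 1) (Lmat [a1] [a2] 0))
      (Lambda m (1 + 1) (1 + 1) (Lmat [b1] [b2] 0)) \<longleftrightarrow>
    (\<exists>Q \<in> GL (1 + 1). \<exists>R \<in> GL (1 + 1). Lmat [a1] [a2] 0 * const_mat R = const_mat Q * Lmat [b1] [b2] 0)"
    by (subst Lambda_Lmat_equivalent_iff) (use m2 ind in simp_all)
  then show "equivalent (m + 2) (Lambda m 2 2 (Lmat [a1] [a2] 0)) (Lambda m 2 2 (Lmat [b1] [b2] 0)) \<longleftrightarrow>
         (\<exists>g \<in> GLDD2. poly_row [b1, b2] = poly_row [a1, a2] * const_mat g)"
    using Lmat_1_1_zero_orbit_iff[OF nz] by (simp only: one_add_one)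
next
  fix a1 a2 a b1 b2 b :: "'k poly"
  assume H: "Lmat [a1] [a2] a \<in> frakL11_dim3 \<and> Lmat [b1] [b2] b \<in> frakL11_dim3 \<and>
      {a1, a2, a, b1, b2, b} \<subseteq> p_polys p \<and>
      Lambda m 2 2 (Lmat [a1] [a2] a) \<in> (daleth_V m)\<^sup>E \<and>
      Lambda m 2 2 (Lmat [b1] [b2] b) \<in> (daleth_V m)\<^sup>E"
  have m2: "1 + 1 \<le> m" using H by (auto simp: Exp_part_def daleth_V_def)
  have L: "Lmat [a1] [a2] a \<in> frakL 1 1" "Lmat [b1] [b2] b \<in> frakL 1 1"
    using H by (auto simp: frakL11_dim3_def)
  note ind = Lmat_frakL[OF L(1)] Lmat_frakL[OF L(2)]
  have a2: "a2 \<noteq> 0" using lin_indep_nth_nonzero[OF ind(2), of 0] by simp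
  \<comment> \<open>The dimension is known for some presentation of the matrix, which
    \<open>Lmat_inj\<close> identifies with the given one.\<close>
  obtain c1 c2 c where c: "Lmat [b1] [b2] b = Lmat [c1] [c2] c"
    "poly_vs.dim (poly_vs.span {c1, c2, c}) = 3"
    using H unfolding frakL11_dim3_def by blast
  have "poly_vs.dim (poly_vs.span (set [b1, b2, b])) = length [b1, b2, b]"
    using c(2) Lmat_inj[OF c(1)] by simp
  then have ind3: "lin_indep [b1, b2, b]" by (rule lin_indep_of_dim)
  have "equivalent (m + 2) (Lambda m (1 + 1) (1 + 1) (Lmat [a1] [a2] a))
      (Lambda m (1 + 1) (1 + 1) (Lmat [b1] [b2] b)) \<longleftrightarrow>
    (\<exists>Q \<in> GL (1 + 1). \<exists>R \<in> GL (1 + 1). Lmat [a1] [a2] a * const_mat R = const_mat Q * Lmat [b1] [b2] b)"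
    by (subst Lambda_Lmat_equivalent_iff) (use m2 ind in simp_all)
  also have "\<dots> \<longleftrightarrow> (\<exists>g \<in> V 1 1 1.
      poly_row ([b1] @ [b2] @ [b]) = poly_row ([a1] @ [a2] @ [a]) * const_mat g)"
    by (rule Lmat_orbit_iff[OF _ _ _ _ Lmat_1_1_corner_vanishes[OF ind3 a2]]) simp_all
  finally show "equivalent (m + 2) (Lambda m 2 2 (Lmat [a1] [a2] a)) (Lambda m 2 2 (Lmat [b1] [b2] b)) \<longleftrightarrow>
         (\<exists>g \<in> V 1 1 1. poly_row [b1, b2, b] = poly_row [a1, a2, a] * const_mat g)"
    by (simp only: one_add_one append.simps)
next
  fix i j i' j' and as as' :: "'k poly list" and a and bs bs' :: "'k poly list" and b
  assume H: "1 \<le> i \<and> 1 \<le> j \<and> 1 \<le> i' \<and> 1 \<le> j' \<and>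
      3 \<le> i + j \<and> i + j \<le> m \<and> 3 \<le> i' + j' \<and> i' + j' \<le> m \<and>
      length as = i \<and> length as' = j \<and> Lmat as as' a \<in> frakL i j \<and>
      length bs = i' \<and> length bs' = j' \<and> Lmat bs bs' b \<in> frakL i' j' \<and>
      set (as @ as' @ [a]) \<subseteq> p_polys p \<and> set (bs @ bs' @ [b]) \<subseteq> p_polys p \<and>
      Lambda m (j + 1) (i + 1) (Lmat as as' a) \<in> (daleth_VI m)\<^sup>E \<and>
      Lambda m (j' + 1) (i' + 1) (Lmat bs bs' b) \<in> (daleth_VI m)\<^sup>E"
  then have len: "length as = i" "length as' = j" "length bs = i'" "length bs' = j'"
    and ij: "1 \<le> i" "1 \<le> j" "i + j \<le> m" "1 \<le> i'" "1 \<le> j'" "i' + j' \<le> m" "3 \<le> i + j"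
    and L: "Lmat as as' a \<in> frakL i j" "Lmat bs bs' b \<in> frakL i' j'" by blast+
  note ind = Lmat_frakL[OF L(1)] Lmat_frakL[OF L(2)]
  \<comment> \<open>The orbit criterion needs families of matching lengths. If the sizes differ,
    both sides of the final equivalence are false.\<close>
  have "(\<exists>Q \<in> GL (j + 1). \<exists>R \<in> GL (i + 1). Lmat as as' a * const_mat R = const_mat Q * Lmat bs bs' b) \<longleftrightarrow>
      (\<exists>g \<in> V i j 1. poly_row (bs @ bs' @ [b]) = poly_row (as @ as' @ [a]) * const_mat g)"
    if "i = i'" "j = j'"
  proof -
    have len': "length bs = i" "length bs' = j" using len that by simp_all
    show ?thesis
      by (rule Lmat_orbit_iff[OF len(1,2) len'
            Lmat_corner_vanishes[OF len(1,2) len' ij(1,2,7) ind(2,3)]])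
  qed
  then show "equivalent (m + 2)
           (Lambda m (j + 1) (i + 1) (Lmat as as' a))
           (Lambda m (j' + 1) (i' + 1) (Lmat bs bs' b)) \<longleftrightarrow>
         (i, j) = (i', j') \<and>
         (\<exists>g \<in> V i j 1. poly_row (bs @ bs' @ [b]) = poly_row (as @ as' @ [a]) * const_mat g)"
    unfolding Lambda_Lmat_equivalent_iff[OF len ij(1-6) ind] by auto
qed

end
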